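(* Let $G=([m],E)$ be an undirected graph, where $E$ contains all self-loops, and let $n\ge 1$. Let $S=(s_{ij})$ be a symmetric $m\times m$ matrix of unknowns ($s_{ij}=s_{ji}$), and let $I_{G,n}$ be the elimination ideal obtained from the ideal of $(n+1)\times(n+1)$-minors of $S$ in $\mathbb{R}[s_{ij} : 1\le i\le j\le m]$ by eliminating all unknowns $s_{ij}$ corresponding to nonedges of $G$, i.e. the intersection of that ideal with the polynomial subring $\mathbb{R}[s_{ij} : (i,j)\in E]$. If $I_{G,n}$ is the zero ideal, then the MLE in the Gaussian graphical model on $G$ exists with probability one for $n$ observations.
   Context: Let $G=([m],E)$ be an undirected graph on $[m]=\{1,\dots,m\}$; $E$ is taken to contain all self-loops $(i,i)$. The (mean zero) Gaussian graphical model on $G$ is the family of distributions $\mathcal{N}(0,\Sigma)$ on $\mathbb{R}^m$ with $\Sigma$ symmetric positive definite and $(\Sigma^{-1})_{ij}=0$ for all $(i,j)\notin E$. Let $\mathcal{K}_G$ be the set of symmetric positive definite $m\times m$ matrices $K$ with $K_{ij}=0$ for all $(i,j)\notin E$. Given observations $X_1,\dots,X_n\in\mathbb{R}^m$, the sample covariance matrix is $S=\frac1n\sum_{k=1}^n X_kX_k^T$ (the mean is known to be zero). The maximum likelihood estimator (MLE) exists for these observations if the log-likelihood $K\mapsto \log\det K-\operatorname{tr}(SK)$ attains its maximum over $\mathcal{K}_G$; by a theorem of Dempster this holds if and only if there is a positive definite matrix $\hat\Sigma$ with $\hat\Sigma_{ij}=S_{ij}$ for all $(i,j)\in E$ (diagonal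 entries included). "The MLE exists with probability one for $n$ observations" means that it exists almost surely when $X_1,\dots,X_n$ are independent draws from a distribution $\mathcal{N}(0,\Sigma)$ in the model. *)

theory Defs
  imports
    "HOL-Probability.Probability"
    "HOL-Library.Poly_Mapping"
    "HOL-Library.Uprod"
    "Jordan_Normal_Form.Determinant"
begin

no_notation Matrix.vec_index (infixl "$" 100)

text \<open>
  The vertex set \<open>[m]\<close> is a finite type \<open>'m\<close>; a graph is its edge relation
  \<open>E :: ('m \<times> 'm) set\<close>. Matrices over \<open>'m\<close> are those of \<open>HOL-Analysis\<close>. The matrices of
  \<open>Jordan_Normal_Form\<close> are used only for minors, whose size is a term and not a type.
\<close>

subsection \<open>The elimination ideal\<close>

text \<open>A real polynomial maps monomials to coefficients; a monomial maps variables to exponents.\<close>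

type_synonym 'v mpoly = "('v \<Rightarrow>\<^sub>0 nat) \<Rightarrow>\<^sub>0 real"

definition mpoly_vars :: "'v mpoly \<Rightarrow> 'v set" where
  "mpoly_vars p = (\<Union>t \<in> Poly_Mapping.keys p. Poly_Mapping.keys t)"

text \<open>
  Indexing the unknowns by unordered pairs (loops included) builds in \<open>s\<^sub>i\<^sub>j = s\<^sub>j\<^sub>i\<close>, so
  \<open>'m uprod mpoly\<close> is the polynomial ring in the unknowns \<open>s\<^sub>i\<^sub>j\<close> with \<open>i \<le> j\<close>.
\<close>

definition unknown :: "'m \<Rightarrow> 'm \<Rightarrow> 'm uprod mpoly" where
  "unknown i j = Poly_Mapping.single (Poly_Mapping.single (Upair i j) 1) 1"

text \<open>
  Rows and columns are selected by injective enumerations \<open>r\<close> and \<open>c\<close>. Reordering an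
  enumeration changes the determinant at most by a sign, so this set consists of the usual
  minors up to sign and generates the same ideal. It is empty if \<open>k > CARD('m)\<close>.
\<close>

definition minors :: "nat \<Rightarrow> 'm uprod mpoly set" where
  "minors k = {Determinant.det (Matrix.mat k k (\<lambda>(a, b). unknown (r a) (c b))) | r c.
     inj_on r {..<k} \<and> inj_on c {..<k}}"

text \<open>The ideal generated by a subset of a commutative ring is its span over the ring itself.\<close>

lemma module_times: "Modules.module ((*) :: 'a::comm_ring_1 \<Rightarrow> 'a \<Rightarrow> 'a)"
  by unfold_locales (simp_all add: algebra_simps)

definition ideal_generated :: "'a::comm_ring_1 set \<Rightarrow> 'a set" where
  "ideal_generated B = Modules.module.span (*) B"

definition edge_subring :: "('m \<times> 'm) set \<Rightarrow> 'm uprod mpoly set" where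
  "edge_subring E = {p. mpoly_vars p \<subseteq> {Upair i j | i j. (i, j) \<in> E}}"

definition elimination_ideal :: "('m \<times> 'm) set \<Rightarrow> nat \<Rightarrow> 'm uprod mpoly set" where
  "elimination_ideal E n = ideal_generated (minors (n + 1)) \<inter> edge_subring E"

subsection \<open>Gaussian graphical models and maximum likelihood\<close>

definition pos_def :: "real^'m^'m \<Rightarrow> bool" where
  "pos_def A \<longleftrightarrow> Finite_Cartesian_Product.transpose A = A \<and> (\<forall>x. x \<noteq> 0 \<longrightarrow> x \<bullet> (A *v x) > 0)"

definition concentration_matrices :: "('m \<times> 'm) set \<Rightarrow> (real^'m^'m) set" where
  "concentration_matrices E = {K. pos_def K \<and> (\<forall>i j. (i, j) \<notin> E \<longrightarrow> K $ i $ j = 0)}"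

definition gaussian :: "real^'m^'m \<Rightarrow> (real^'m) measure" where
  "gaussian \<Sigma> = density lborel (\<lambda>x. ennreal
     (exp (- (x \<bullet> (matrix_inv \<Sigma> *v x)) / 2) / sqrt ((2 * pi) ^ CARD('m) * Determinants.det \<Sigma>)))"

definition gaussian_model :: "('m \<times> 'm) set \<Rightarrow> (real^'m) measure set" where
  "gaussian_model E = {gaussian \<Sigma> | \<Sigma>.
     pos_def \<Sigma> \<and> (\<forall>i j. (i, j) \<notin> E \<longrightarrow> matrix_inv \<Sigma> $ i $ j = 0)}"

definition sample_covariance :: "nat \<Rightarrow> (nat \<Rightarrow> real^'m) \<Rightarrow> real^'m^'m" where
  "sample_covariance n x = (1 / real n) *\<^sub>R (\<Sum>k<n. (\<chi> i j. x k $ i * x k $ j))"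

definition log_likelihood :: "real^'m^'m \<Rightarrow> real^'m^'m \<Rightarrow> real" where
  "log_likelihood S K = ln (Determinants.det K) - Determinants.trace (S ** K)"

definition mle_exists :: "('m \<times> 'm) set \<Rightarrow> real^'m^'m \<Rightarrow> bool" where
  "mle_exists E S \<longleftrightarrow> (\<exists>K \<in> concentration_matrices E.
     \<forall>K' \<in> concentration_matrices E. log_likelihood S K' \<le> log_likelihood S K)"

end

theory Submission
  imports Defs
begin

text \<open>
  The MLE exists as soon as no nonzero symmetric matrix \<open>K\<close> supported on \<open>E\<close> satisfies
  \<open>K X\<^sub>k = 0\<close> for all \<open>k\<close>: then \<open>tr (S K)\<close> is bounded below by a multiple of the norm on the
  positive semidefinite \<open>K\<close> supported on \<open>E\<close>, and the log-likelihood attains its maximum by compactness.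
  Now \<open>K X = 0\<close> says exactly that \<open>K\<close> is orthogonal to the image of the derivative at \<open>X\<close> of the Gram map
  \<open>X \<mapsto> (\<Sum>\<^sub>k X\<^sub>i\<^sub>k X\<^sub>j\<^sub>k)\<close>, \<open>(i, j) \<in> E\<close>. If the components of the Gram map are algebraically independent,
  this derivative is surjective wherever finitely many nonzero polynomials do not vanish, hence almost surely.
  
  Algebraic independence comes from the elimination ideal. Let \<open>f\<close> be a polynomial in the edge unknowns
  that vanishes on all Gram matrices of rank at most \<open>n\<close>, and let \<open>P\<close> be a prime ideal containing the
  \<open>(n + 1)\<close>-minors. Modulo \<open>P\<close> the generic symmetric matrix is \<open>C A C\<^sup>T\<close> up to a denominator, where \<open>A\<close> is
  a principal submatrix of size at most \<open>n\<close>; so \<open>f \<in> P\<close>. Hence a power of \<open>f\<close> lies in the ideal generated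
  by the minors, and therefore in the elimination ideal, so that \<open>f = 0\<close>.
\<close>

subsection \<open>Polynomial functions and the Jacobian criterion\<close>

text \<open>Induction on the equations: an equation with a nonzero coefficient eliminates one
  unknown. Arbitrary finite index sets let the unknowns be indexed by exponent vectors in one use
  and by the coordinates of a tangent vector in another.\<close>

lemma homogeneous_system_nontrivial:
  fixes a :: "'t \<Rightarrow> 's \<Rightarrow> 'a::field"
  assumes "finite S" and "finite T" and "card S < card T"
  shows "\<exists>c. (\<exists>t\<in>T. c t \<noteq> 0) \<and> (\<forall>s\<in>S. (\<Sum>t\<in>T. c t * a t s) = 0)"
  using assms
proof (induction S arbitrary: T a rule: finite_induct)
  case empty
  then have "T \<noteq> {}" by auto
  then show ?case by (intro exI[of _ "\<lambda>_. 1"]) auto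
next
  case (insert s S)
  show ?case
  proof (cases "\<forall>t\<in>T. a t s = 0")
    case True
    from insert.prems insert.hyps have "card S < card T" by auto
    from insert.IH[OF insert.prems(1) this, of a] obtain c where
      c: "\<exists>t\<in>T. c t \<noteq> 0" "\<forall>s\<in>S. (\<Sum>t\<in>T. c t * a t s) = 0" by blast
    with True show ?thesis by (intro exI[of _ c]) auto
  next
    case False
    then obtain t0 where t0: "t0 \<in> T" "a t0 s \<noteq> 0" by auto
    let ?T = "T - {t0}"
    let ?a = "\<lambda>t s'. a t s' - a t s / a t0 s * a t0 s'"
    have "card S < card ?T" using insert t0 by (auto simp: card_Diff_singleton)
    from insert.IH[of ?T ?a, OF _ this] insert.prems obtain c where
      c: "\<exists>t\<in>?T. c t \<noteq> 0" "\<forall>s'\<in>S. (\<Sum>t\<in>?T. c t * ?a t s') = 0" by auto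
    \<comment> \<open>The value of the eliminated unknown \<open>t0\<close> that makes equation
      \<open>s\<close> hold.\<close>
    let ?w = "- (\<Sum>t\<in>?T. c t * a t s) / a t0 s"
    let ?c = "c(t0 := ?w)"
    have split: "(\<Sum>t\<in>T. ?c t * a t s') = ?w * a t0 s' + (\<Sum>t\<in>?T. c t * a t s')" for s'
      using insert.prems t0 by (subst sum.remove[of _ t0]) (auto intro!: arg_cong2[of _ _ _ _ "(+)"] sum.cong)
    have "(\<Sum>t\<in>T. ?c t * a t s') = 0" if "s' \<in> S" for s'
    proof -
      have "0 = (\<Sum>t\<in>?T. c t * ?a t s')" using c that by simp
      also have "\<dots> = (\<Sum>t\<in>?T. c t * a t s') - (\<Sum>t\<in>?T. c t * a t s) / a t0 s * a t0 s'"
        by (simp add: algebra_simps sum_subtractf sum_distrib_left sum_divide_distrib)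
      finally show ?thesis unfolding split by simp
    qed
    moreover have "(\<Sum>t\<in>T. ?c t * a t s) = 0" unfolding split using t0 by simp
    moreover have "\<exists>t\<in>T. ?c t \<noteq> 0" using c(1) by auto
    ultimately show ?thesis by (intro exI[of _ ?c]) auto
  qed
qed

abbreviation exps :: "'i set \<Rightarrow> nat \<Rightarrow> ('i \<Rightarrow> nat) set" where
  "exps I d \<equiv> PiE I (\<lambda>_. {..d})"

text \<open>The bound \<open>d\<close> applies to the exponent of each variable separately and not
  to the total degree, so that for finite \<open>V\<close> there are \<open>(d + 1) ^ card V\<close>
  monomials.\<close>

definition poly_fun :: "'v set \<Rightarrow> nat \<Rightarrow> (('v \<Rightarrow> real) \<Rightarrow> real) \<Rightarrow> bool" where
  "poly_fun V d f \<longleftrightarrow> (\<exists>a. \<forall>x. f x = (\<Sum>s\<in>exps V d. a s * (\<Prod>v\<in>V. x v ^ s v)))"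

text \<open>Relations are tested pointwise, but only those with all coefficients zero count as
  trivial. Exponent vectors are extensional functions, so distinct ones stand for distinct formal
  monomials.\<close>

definition alg_indep :: "'i set \<Rightarrow> ('i \<Rightarrow> 'x \<Rightarrow> real) \<Rightarrow> bool" where
  "alg_indep I y \<longleftrightarrow> (\<forall>d c. (\<forall>x. (\<Sum>t\<in>exps I d. c t * (\<Prod>i\<in>I. y i x ^ t i)) = 0)
     \<longrightarrow> (\<forall>t\<in>exps I d. c t = 0))"

text \<open>Terms whose exponents agree on \<open>V\<close> are collected, so sums and products may
  be written over any convenient index set.\<close>

lemma poly_funI_finite:
  assumes V: "finite V" and K: "finite K" and e: "\<And>k v. k \<in> K \<Longrightarrow> v \<in> V \<Longrightarrow> e k v \<le> d"
    and f: "\<And>x. f x = (\<Sum>k\<in>K. a k * (\<Prod>v\<in>V. x v ^ e k v))"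
  shows "poly_fun V d f"
proof -
  let ?h = "\<lambda>k. restrict (e k) V"
  have "f x = (\<Sum>s\<in>exps V d. (\<Sum>k\<in>{k\<in>K. ?h k = s}. a k) * (\<Prod>v\<in>V. x v ^ s v))" for x
  proof -
    have "f x = (\<Sum>s\<in>exps V d. \<Sum>k\<in>{k\<in>K. ?h k = s}. a k * (\<Prod>v\<in>V. x v ^ e k v))"
      unfolding f by (rule sum.group[symmetric]) (use K V e in \<open>auto intro!: finite_PiE\<close>)
    also have "\<dots> = (\<Sum>s\<in>exps V d. \<Sum>k\<in>{k\<in>K. ?h k = s}. a k * (\<Prod>v\<in>V. x v ^ s v))"
      by (intro sum.cong refl arg_cong2[of _ _ _ _ "(*)"] prod.cong) auto
    finally show ?thesis by (simp add: sum_distrib_right)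
  qed
  then show ?thesis unfolding poly_fun_def by (intro exI allI)
qed

lemma finite_exps [simp]: "finite I \<Longrightarrow> finite (exps I d)"
  by (rule finite_PiE) auto

lemma poly_fun_mono:
  assumes "finite V" and "poly_fun V d f" and "d \<le> d'"
  shows "poly_fun V d' f"
proof -
  from assms(2) obtain a where "\<And>x. f x = (\<Sum>s\<in>exps V d. a s * (\<Prod>v\<in>V. x v ^ s v))"
    unfolding poly_fun_def by blast
  then show ?thesis by (intro poly_funI_finite[of V "exps V d" "\<lambda>s. s" d' f a]) (use assms(1,3) PiE_mem in \<open>fastforce+\<close>)
qed

lemma poly_fun_const: "finite V \<Longrightarrow> poly_fun V 0 (\<lambda>_. c)"
  by (rule poly_funI_finite[of V "{()}" "\<lambda>_ _. 0" _ _ "\<lambda>_. c"]) auto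

lemma poly_fun_coord:
  assumes "finite V" and "w \<in> V" shows "poly_fun V 1 (\<lambda>x. x w)"
proof (rule poly_funI_finite[of V "{()}" "\<lambda>_ v. if v = w then 1 else 0" _ _ "\<lambda>_. 1"])
  fix x :: "'a \<Rightarrow> real"
  have "(\<Prod>v\<in>V. x v ^ (if v = w then 1 else 0)) = (\<Prod>v\<in>V. if v = w then x v else 1)"
    by (rule prod.cong) auto
  then show "x w = (\<Sum>k\<in>{()}. 1 * (\<Prod>v\<in>V. x v ^ (if v = w then 1 else 0)))"
    using assms by simp
qed (use assms in auto)

lemma poly_fun_mult:
  assumes V: "finite V" and "poly_fun V d f" and "poly_fun V e g"
  shows "poly_fun V (d + e) (\<lambda>x. f x * g x)"
proof -
  from assms obtain a b where
    f: "\<And>x. f x = (\<Sum>s\<in>exps V d. a s * (\<Prod>v\<in>V. x v ^ s v))" and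
    g: "\<And>x. g x = (\<Sum>s\<in>exps V e. b s * (\<Prod>v\<in>V. x v ^ s v))"
    unfolding poly_fun_def by blast
  show ?thesis
  proof (rule poly_funI_finite[of V "exps V d \<times> exps V e" "\<lambda>p v. fst p v + snd p v" _ _ "\<lambda>p. a (fst p) * b (snd p)"])
    show "f x * g x = (\<Sum>p\<in>exps V d \<times> exps V e. a (fst p) * b (snd p) * (\<Prod>v\<in>V. x v ^ (fst p v + snd p v)))" for x
      unfolding f g sum_product sum.cartesian_product
      by (rule sum.cong) (auto simp: power_add prod.distrib)
  qed (use V in \<open>auto intro!: add_mono dest: PiE_mem\<close>)
qed

lemma poly_fun_add:
  assumes V: "finite V" and "poly_fun V d f" and "poly_fun V e g"
  shows "poly_fun V (max d e) (\<lambda>x. f x + g x)"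
proof -
  from poly_fun_mono[OF V, of _ _ "max d e"] assms
  have "poly_fun V (max d e) f" "poly_fun V (max d e) g" by auto
  then obtain a b where
    f: "\<And>x. f x = (\<Sum>s\<in>exps V (max d e). a s * (\<Prod>v\<in>V. x v ^ s v))" and
    g: "\<And>x. g x = (\<Sum>s\<in>exps V (max d e). b s * (\<Prod>v\<in>V. x v ^ s v))"
    unfolding poly_fun_def by blast
  show ?thesis unfolding poly_fun_def f g
    by (intro exI[of _ "\<lambda>s. a s + b s"]) (simp add: sum.distrib algebra_simps)
qed

lemma poly_fun_prod:
  assumes V: "finite V" and "finite I" and "\<And>i. i \<in> I \<Longrightarrow> poly_fun V (d i) (f i)"
  shows "poly_fun V (\<Sum>i\<in>I. d i) (\<lambda>x. \<Prod>i\<in>I. f i x)"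
  using assms(2,3)
  by (induction rule: finite_induct) (auto intro: poly_fun_const poly_fun_mult V)

lemma poly_fun_power:
  assumes V: "finite V" and "poly_fun V d f"
  shows "poly_fun V (k * d) (\<lambda>x. f x ^ k)"
  using poly_fun_prod[OF V, of "{..<k}" "\<lambda>_. d" "\<lambda>_. f"] assms by simp

definition polynomial_fun :: "'v set \<Rightarrow> (('v \<Rightarrow> real) \<Rightarrow> real) \<Rightarrow> bool" where
  "polynomial_fun V f \<longleftrightarrow> (\<exists>d. poly_fun V d f)"

lemma polynomial_fun_intros:
  assumes "finite V"
  shows "polynomial_fun V (\<lambda>_. c)"
    and "v \<in> V \<Longrightarrow> polynomial_fun V (\<lambda>x. x v)"
    and "polynomial_fun V f \<Longrightarrow> polynomial_fun V g \<Longrightarrow> polynomial_fun V (\<lambda>x. f x + g x)"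
    and "polynomial_fun V f \<Longrightarrow> polynomial_fun V g \<Longrightarrow> polynomial_fun V (\<lambda>x. f x * g x)"
    and "polynomial_fun V f \<Longrightarrow> polynomial_fun V (\<lambda>x. f x ^ k)"
  unfolding polynomial_fun_def using assms
  by (blast intro: poly_fun_const poly_fun_coord poly_fun_add poly_fun_mult poly_fun_power)+

lemma polynomial_fun_sum:
  assumes "finite V" and "\<And>i. i \<in> I \<Longrightarrow> polynomial_fun V (f i)"
  shows "polynomial_fun V (\<lambda>x. \<Sum>i\<in>I. f i x)"
  using assms(2) by (induction I rule: infinite_finite_induct) (auto intro: polynomial_fun_intros assms(1))

lemma polynomial_fun_prod:
  assumes "finite V" and "\<And>i. i \<in> I \<Longrightarrow> polynomial_fun V (f i)"
  shows "polynomial_fun V (\<lambda>x. \<Prod>i\<in>I. f i x)"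
  using assms(2) by (induction I rule: infinite_finite_induct) (auto intro: polynomial_fun_intros assms(1))

text \<open>
  Products of the \<open>y i\<close> with exponents at most \<open>d\<close> are \<open>(d + 1) ^ card I\<close> many, but they lie in a space
  whose dimension grows only like \<open>d ^ card V\<close>.
\<close>

lemma alg_indep_card_le:
  assumes V: "finite V" and I: "finite I" and y: "\<And>i. i \<in> I \<Longrightarrow> polynomial_fun V (y i)"
    and indep: "alg_indep I y"
  shows "card I \<le> card V"
proof (rule ccontr)
  assume "\<not> card I \<le> card V"
  then have lt: "card V < card I" by simp
  from y obtain D0 where D0: "\<And>i. i \<in> I \<Longrightarrow> poly_fun V (D0 i) (y i)"
    unfolding polynomial_fun_def by metis
  define D where "D = (\<Sum>i\<in>I. D0 i)"
  have D: "poly_fun V D (y i)" if "i \<in> I" for i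
    using that I unfolding D_def by (intro poly_fun_mono[OF V D0]) (auto intro: member_le_sum)
  \<comment> \<open>\<open>M\<close> makes the base \<open>card I * (d * D) + 1\<close> at most
    \<open>M * (d + 1)\<close>. The remaining constant \<open>M ^ card V\<close> is then
    \<open>d\<close>, which is beaten by one extra factor \<open>d + 1\<close>.\<close>
  define M where "M = card I * D + 1"
  define d where "d = M ^ card V"
  have "(card I * (d * D) + 1) ^ card V \<le> (M * (d + 1)) ^ card V"
    by (rule power_mono) (auto simp: M_def algebra_simps)
  also have "\<dots> = d * (d + 1) ^ card V" by (simp only: d_def power_mult_distrib)
  also have "\<dots> < (d + 1) * (d + 1) ^ card V" by simp
  also have "\<dots> = (d + 1) ^ Suc (card V)" by simp
  also have "\<dots> \<le> (d + 1) ^ card I" using lt by (intro power_increasing) auto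
  finally have lt: "card (exps V (card I * (d * D))) < card (exps I d)"
    using V I by (simp add: card_PiE)
  have "poly_fun V (card I * (d * D)) (\<lambda>x. \<Prod>i\<in>I. y i x ^ t i)" if t: "t \<in> exps I d" for t
  proof (rule poly_fun_mono[OF V])
    show "poly_fun V (\<Sum>i\<in>I. t i * D) (\<lambda>x. \<Prod>i\<in>I. y i x ^ t i)"
      by (intro poly_fun_prod poly_fun_power V I D)
    have "t i * D \<le> d * D" if "i \<in> I" for i using t that by (auto dest: PiE_mem)
    then show "(\<Sum>i\<in>I. t i * D) \<le> card I * (d * D)" using sum_bounded_above[of I "\<lambda>i. t i * D" "d * D"] by simp
  qed
  then have ex: "\<exists>b. \<forall>x. (\<Prod>i\<in>I. y i x ^ t i)
      = (\<Sum>s\<in>exps V (card I * (d * D)). b s * (\<Prod>v\<in>V. x v ^ s v))"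
    if "t \<in> exps I d" for t
    using that unfolding poly_fun_def .
  from bchoice[OF ballI[OF ex]] obtain b where b: "\<forall>t\<in>exps I d. \<forall>x. (\<Prod>i\<in>I. y i x ^ t i)
      = (\<Sum>s\<in>exps V (card I * (d * D)). b t s * (\<Prod>v\<in>V. x v ^ s v))" ..
  \<comment> \<open>There are more products than monomials to expand them in, so some nontrivial
    combination of the products has all its monomial coefficients zero.\<close>
  from homogeneous_system_nontrivial[OF _ _ lt, of b] V I obtain c where
    c: "\<exists>t\<in>exps I d. c t \<noteq> 0" "\<forall>s\<in>exps V (card I * (d * D)). (\<Sum>t\<in>exps I d. c t * b t s) = 0"
    by auto
  have "(\<Sum>t\<in>exps I d. c t * (\<Prod>i\<in>I. y i x ^ t i)) = 0" for x
  proof -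
    have "(\<Sum>t\<in>exps I d. c t * (\<Prod>i\<in>I. y i x ^ t i))
      = (\<Sum>t\<in>exps I d. \<Sum>s\<in>exps V (card I * (d * D)). c t * b t s * (\<Prod>v\<in>V. x v ^ s v))"
      by (simp add: b sum_distrib_left mult.assoc)
    also have "\<dots> = (\<Sum>s\<in>exps V (card I * (d * D)). (\<Sum>t\<in>exps I d. c t * b t s) * (\<Prod>v\<in>V. x v ^ s v))"
      by (subst sum.swap) (simp add: sum_distrib_right)
    also have "\<dots> = 0" using c(2) by simp
    finally show ?thesis .
  qed
  with indep c(1) show False unfolding alg_indep_def by blast
qed

text \<open>
  A relation of least degree in \<open>y k\<close> is separable: its derivative with respect to \<open>y k\<close> would otherwise
  be a relation of smaller degree (characteristic 0).
\<close>

lemma alg_dependent_separable: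
  fixes y :: "'i \<Rightarrow> 'x \<Rightarrow> real"
  assumes K: "finite K" and k: "k \<notin> K" and indep: "alg_indep K y" and dep: "\<not> alg_indep (insert k K) y"
  obtains N d c where
    "\<And>x. (\<Sum>l\<le>N. (\<Sum>t\<in>exps K d. c l t * (\<Prod>i\<in>K. y i x ^ t i)) * y k x ^ l) = 0"
    "\<exists>x. (\<Sum>l\<le>N. (\<Sum>t\<in>exps K d. c l t * (\<Prod>i\<in>K. y i x ^ t i)) * (real l * y k x ^ (l - 1))) \<noteq> 0"
proof -
  define F where "F d c x = (\<Sum>t\<in>exps K d. c t * (\<Prod>i\<in>K. y i x ^ t i))" for d c x
  \<comment> \<open>Relations read as univariate polynomials of degree at most \<open>N\<close> in
    \<open>y k\<close>, whose coefficients are polynomials in the \<open>y i\<close> with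
    \<open>i\<close> in \<open>K\<close>.\<close>
  define rel where "rel N d c \<longleftrightarrow> (\<exists>l\<le>N. \<exists>t\<in>exps K d. c l t \<noteq> 0) \<and> (\<forall>x. (\<Sum>l\<le>N. F d (c l) x * y k x ^ l) = 0)"
    for N d and c :: "nat \<Rightarrow> ('i \<Rightarrow> nat) \<Rightarrow> real"
  from dep obtain d c where dc: "\<And>x. (\<Sum>t\<in>exps (insert k K) d. c t * (\<Prod>i\<in>insert k K. y i x ^ t i)) = 0"
    "\<exists>t\<in>exps (insert k K) d. c t \<noteq> 0" unfolding alg_indep_def by blast
  have inj: "inj_on (\<lambda>(l, g). g(k := l)) ({..d} \<times> exps K d)"
    using inj_combinator[OF k, of "\<lambda>_. {..d}"] by simp
  have bx: "exps (insert k K) d = (\<lambda>(l, g). g(k := l)) ` ({..d} \<times> exps K d)"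
    by (simp add: PiE_insert_eq)
  have "rel d d (\<lambda>l t. c (t(k := l)))"
    unfolding rel_def
  proof (intro conjI allI)
    show "\<exists>l\<le>d. \<exists>t\<in>exps K d. c (t(k := l)) \<noteq> 0" using dc(2) unfolding bx by auto
    fix x
    have "(\<Sum>l\<le>d. F d (\<lambda>t. c (t(k := l))) x * y k x ^ l) =
      (\<Sum>(l, t)\<in>{..d} \<times> exps K d. c (t(k := l)) * (\<Prod>i\<in>insert k K. y i x ^ (t(k := l)) i))"
      unfolding sum.cartesian_product[symmetric] F_def sum_distrib_right
    proof (intro sum.cong refl)
      fix l t
      have "(\<Prod>i\<in>K. y i x ^ (t(k := l)) i) = (\<Prod>i\<in>K. y i x ^ t i)"
        using k by (intro prod.cong) auto
      then show "c (t(k := l)) * (\<Prod>i\<in>K. y i x ^ t i) * y k x ^ l =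
          c (t(k := l)) * (\<Prod>i\<in>insert k K. y i x ^ (t(k := l)) i)"
        using K k by (simp add: mult_ac)
    qed
    also have "\<dots> = (\<Sum>t\<in>exps (insert k K) d. c t * (\<Prod>i\<in>insert k K. y i x ^ t i))"
      unfolding bx by (subst sum.reindex[OF inj]) (auto simp: case_prod_unfold)
    finally show "(\<Sum>l\<le>d. F d (\<lambda>t. c (t(k := l))) x * y k x ^ l) = 0" using dc(1) by simp
  qed
  then have ex: "\<exists>N d c. rel N d c" by blast
  define N where "N = (LEAST N. \<exists>d c. rel N d c)"
  obtain d c where dc: "rel N d c" using LeastI_ex[OF ex] unfolding N_def by blast
  have least: "\<not> rel N' d c" if "N' < N" for N' d c using not_less_Least that unfolding N_def by blast
  have "\<exists>x. (\<Sum>l\<le>N. F d (c l) x * (real l * y k x ^ (l - 1))) \<noteq> 0"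
  proof (rule ccontr)
    assume "\<nexists>x. (\<Sum>l\<le>N. F d (c l) x * (real l * y k x ^ (l - 1))) \<noteq> 0"
    then have z: "\<And>x. (\<Sum>l\<le>N. F d (c l) x * (real l * y k x ^ (l - 1))) = 0" by auto
    \<comment> \<open>Shifting the index turns the derivative into a relation of degree
      \<open>N - 1\<close>. Minimality of \<open>N\<close> makes it trivial, and dividing by the
      nonzero number \<open>l\<close> kills \<open>c l\<close>.\<close>
    have high: "c l t = 0" if "1 \<le> l" "l \<le> N" "t \<in> exps K d" for l t
    proof -
      from that obtain N' where N': "N = Suc N'" by (cases N) auto
      have "(\<Sum>l\<le>N'. F d (\<lambda>t. real (Suc l) * c (Suc l) t) x * y k x ^ l) = 0" for x
      proof -
        have "(\<Sum>l\<le>N'. F d (\<lambda>t. real (Suc l) * c (Suc l) t) x * y k x ^ l)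
          = (\<Sum>l\<le>N'. F d (c (Suc l)) x * (real (Suc l) * y k x ^ l))"
          by (intro sum.cong refl) (simp add: F_def sum_distrib_left mult_ac)
        also have "\<dots> = (\<Sum>l\<le>N. F d (c l) x * (real l * y k x ^ (l - 1)))"
          unfolding N' by (subst sum.atMost_Suc_shift) simp
        finally show ?thesis using z by simp
      qed
      with least[of N' d "\<lambda>l t. real (Suc l) * c (Suc l) t"] N'
      have "\<forall>l\<le>N'. \<forall>t\<in>exps K d. real (Suc l) * c (Suc l) t = 0" unfolding rel_def by auto
      moreover obtain l' where "l = Suc l'" using \<open>1 \<le> l\<close> by (cases l) auto
      ultimately show ?thesis using that N' by auto
    qed
    \<comment> \<open>Only the term of degree 0 survives, and it is a relation within the
      independent family \<open>K\<close>.\<close>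
    have "F d (c 0) x = 0" for x
    proof -
      have "(\<Sum>l\<le>N. F d (c l) x * y k x ^ l) = F d (c 0) x + (\<Sum>l\<in>{..N} - {0}. F d (c l) x * y k x ^ l)"
        by (subst sum.remove[of _ 0]) auto
      also have "(\<Sum>l\<in>{..N} - {0}. F d (c l) x * y k x ^ l) = 0"
        by (rule sum.neutral) (auto simp: F_def high)
      finally show ?thesis using dc unfolding rel_def by auto
    qed
    with indep have "c 0 t = 0" if "t \<in> exps K d" for t
      using that unfolding alg_indep_def F_def by blast
    with high dc show False unfolding rel_def by (metis less_one linorder_not_le)
  qed
  with dc that[where N = N and d = d and c = c] show thesis unfolding rel_def F_def by blast
qed

text \<open>
  Extend \<open>\<psi>\<close> by coordinates to a maximal independent family. By \<open>alg_dependent_separable\<close> the differentials of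
  this family span everything away from the zeros of \<open>G\<close>, and by \<open>alg_indep_card_le\<close> there are at most \<open>card V\<close> of
  them, so they are linearly independent. The variables of \<open>alg_indep\<close> are indexed by \<open>Inl i\<close> for \<open>\<psi> i\<close> and by
  \<open>Inr v\<close> for the coordinate \<open>v\<close>.
\<close>

theorem jacobian_criterion:
  fixes \<psi> :: "'i \<Rightarrow> ('v \<Rightarrow> real) \<Rightarrow> real"
  assumes V: "finite V" and I: "finite I"
    and \<psi>: "\<And>i. i \<in> I \<Longrightarrow> polynomial_fun V (\<psi> i)"
    and indep: "alg_indep (Inl ` I) (case_sum \<psi> (\<lambda>v x. x v))"
    and deriv: "\<And>i x u. i \<in> I \<Longrightarrow>
      ((\<lambda>s. \<psi> i (\<lambda>v. x v + s * u v)) has_real_derivative (\<Sum>v\<in>V. u v * p i x v)) (at 0)"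
  shows "\<exists>G. finite G \<and> (\<forall>g\<in>G. polynomial_fun V g \<and> (\<exists>x. g x \<noteq> 0)) \<and>
    (\<forall>x \<kappa>. (\<forall>g\<in>G. g x \<noteq> 0) \<longrightarrow> (\<forall>u. (\<Sum>i\<in>I. \<kappa> i * (\<Sum>v\<in>V. u v * p i x v)) = 0) \<longrightarrow> (\<forall>i\<in>I. \<kappa> i = 0))"
proof -
  define y :: "'i + 'v \<Rightarrow> ('v \<Rightarrow> real) \<Rightarrow> real" where "y = case_sum \<psi> (\<lambda>v x. x v)"
  let ?\<T> = "{T. T \<subseteq> V \<and> alg_indep (I <+> T) y}"
  have eq: "I <+> ({} :: 'v set) = Inl ` I" by (simp add: Plus_def)
  have "{} \<in> ?\<T>" unfolding y_def using indep by (simp add: eq)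
  moreover have "finite ?\<T>" using V by auto
  ultimately have "\<exists>T\<in>?\<T>. \<forall>T'\<in>?\<T>. T \<subseteq> T' \<longrightarrow> T = T'"
    by (intro finite_has_maximal) auto
  then obtain T where T: "T \<in> ?\<T>" and max: "\<forall>T'\<in>?\<T>. T \<subseteq> T' \<longrightarrow> T = T'" ..
  let ?K = "I <+> T"
  have TV: "T \<subseteq> V" and fT: "finite T" and fK: "finite ?K" and iK: "alg_indep ?K y"
    using T V I by (auto intro: finite_subset)
  have ypoly: "polynomial_fun V (y k)" if "k \<in> I <+> V" for k
    using that \<psi> polynomial_fun_intros[OF V] by (auto simp: y_def)
  have "card ?K \<le> card V" by (rule alg_indep_card_le[OF V fK ypoly iK]) (use TV in auto)
  then have card: "card I + card T \<le> card V" using I fT by (simp add: card_Plus)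
  define rel where "rel j N d c \<longleftrightarrow>
    (\<forall>x. (\<Sum>l\<le>N. (\<Sum>t\<in>exps ?K d. c l t * (\<Prod>i\<in>?K. y i x ^ t i)) * y (Inr j) x ^ l) = 0) \<and>
    (\<exists>x. (\<Sum>l\<le>N. (\<Sum>t\<in>exps ?K d. c l t * (\<Prod>i\<in>?K. y i x ^ t i)) * (real l * y (Inr j) x ^ (l - 1))) \<noteq> 0)"
    for j N d and c :: "nat \<Rightarrow> ('i + 'v \<Rightarrow> nat) \<Rightarrow> real"
  have "\<exists>N d c. rel j N d c" if j: "j \<in> V - T" for j
  proof -
    have "insert (Inr j) ?K = I <+> insert j T" by auto
    moreover have "insert j T \<notin> ?\<T>" using bspec[OF max, of "insert j T"] j by auto
    ultimately have dep: "\<not> alg_indep (insert (Inr j) ?K) y" using j TV by auto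
    have nin: "Inr j \<notin> ?K" using j by auto
    show ?thesis
    proof (rule alg_dependent_separable[OF fK nin iK dep])
      fix N d c
      assume "\<And>x. (\<Sum>l\<le>N. (\<Sum>t\<in>exps ?K d. c l t * (\<Prod>i\<in>?K. y i x ^ t i)) * y (Inr j) x ^ l) = 0"
        and "\<exists>x. (\<Sum>l\<le>N. (\<Sum>t\<in>exps ?K d. c l t * (\<Prod>i\<in>?K. y i x ^ t i)) * (real l * y (Inr j) x ^ (l - 1))) \<noteq> 0"
      then have "rel j N d c" unfolding rel_def by (intro conjI allI)
      then show ?thesis by (intro exI)
    qed
  qed
  then obtain N d c where ndc: "\<And>j. j \<in> V - T \<Longrightarrow> rel j (N j) (d j) (c j)" by metis
  then have
    rel: "\<And>j x. j \<in> V - T \<Longrightarrow> (\<Sum>l\<le>N j. (\<Sum>t\<in>exps ?K (d j). c j l t * (\<Prod>i\<in>?K. y i x ^ t i)) * y (Inr j) x ^ l) = 0"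
    and sep: "\<And>j. j \<in> V - T \<Longrightarrow> \<exists>x. (\<Sum>l\<le>N j. (\<Sum>t\<in>exps ?K (d j). c j l t * (\<Prod>i\<in>?K. y i x ^ t i)) * (real l * y (Inr j) x ^ (l - 1))) \<noteq> 0"
    unfolding rel_def by auto
  define F where "F j l x = (\<Sum>t\<in>exps ?K (d j). c j l t * (\<Prod>i\<in>?K. y i x ^ t i))" for j l x
  \<comment> \<open>The derivative of the relation of \<open>j\<close> in its last unknown. Where it
    is nonzero, the relation determines the differential of coordinate \<open>j\<close> from those
    of the family.\<close>
  define g where "g j x = (\<Sum>l\<le>N j. F j l x * (real l * x j ^ (l - 1)))" for j x
  show ?thesis
  proof (intro exI[of _ "g ` (V - T)"] conjI ballI allI impI)
    show "finite (g ` (V - T))" using V by auto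
    fix h assume "h \<in> g ` (V - T)"
    then obtain j where j: "j \<in> V - T" and h: "h = g j" by auto
    show "\<exists>x. h x \<noteq> 0" using sep[OF j] by (simp add: h g_def F_def y_def)
    have "polynomial_fun V (\<lambda>x. g j x)"
      unfolding g_def F_def
      by (intro polynomial_fun_sum polynomial_fun_prod polynomial_fun_intros V ypoly) (use j TV in auto)
    then show "polynomial_fun V h" by (simp add: h)
  next
    fix x \<kappa> i0
    assume nz: "\<forall>h\<in>g ` (V - T). h x \<noteq> 0"
      and \<kappa>: "\<forall>u. (\<Sum>i\<in>I. \<kappa> i * (\<Sum>v\<in>V. u v * p i x v)) = 0" and i0: "i0 \<in> I"
    show "\<kappa> i0 = 0"
    proof (rule ccontr)
      assume \<kappa>0: "\<kappa> i0 \<noteq> 0"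
      \<comment> \<open>Without \<open>i0\<close> there are fewer than \<open>card V\<close> linear
        conditions, so a nonzero direction \<open>u\<close> is killed by every differential of the
        family except possibly that of \<open>\<psi> i0\<close>. The dependence
        \<open>\<kappa>\<close> then forces this one to kill \<open>u\<close> as well.\<close>
      let ?S = "(I - {i0}) <+> T"
      have "card I \<ge> 1" using I i0 by (auto simp: Suc_le_eq card_gt_0_iff)
      then have "card ?S < card V" using card I fT i0 by (subst card_Plus) auto
      moreover have "finite ?S" using I fT by simp
      moreover define a where "a v s = (case s of Inl i \<Rightarrow> p i x v | Inr t \<Rightarrow> (if v = t then 1 else 0))" for v s
      ultimately have "\<exists>u. (\<exists>v\<in>V. u v \<noteq> 0) \<and> (\<forall>s\<in>?S. (\<Sum>v\<in>V. u v * a v s) = 0)"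
        using V by (intro homogeneous_system_nontrivial)
      then obtain u where u: "\<exists>v\<in>V. u v \<noteq> 0" "\<forall>s\<in>?S. (\<Sum>v\<in>V. u v * a v s) = 0" by auto
      have du: "(\<Sum>v\<in>V. u v * p i x v) = 0" if "i \<in> I" "i \<noteq> i0" for i
        using bspec[OF u(2) InlI, of i] that by (simp add: a_def)
      have uT: "u t = 0" if "t \<in> T" for t
      proof -
        have "(\<Sum>v\<in>V. u v * (if v = t then 1 else 0)) = 0"
          using bspec[OF u(2) InrI, of t] that by (simp add: a_def)
        also have "(\<Sum>v\<in>V. u v * (if v = t then 1 else 0)) = (\<Sum>v\<in>V. if v = t then u v else 0)"
          by (rule sum.cong) auto
        finally show ?thesis using that TV V by auto
      qed
      have "(\<Sum>i\<in>I. \<kappa> i * (\<Sum>v\<in>V. u v * p i x v)) = \<kappa> i0 * (\<Sum>v\<in>V. u v * p i0 x v)"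
        by (subst sum.remove[OF I i0]) (simp add: du)
      with spec[OF \<kappa>, of u] \<kappa>0 have "(\<Sum>v\<in>V. u v * p i0 x v) = 0" by simp
      with du have du: "(\<Sum>v\<in>V. u v * p i x v) = 0" if "i \<in> I" for i using that by blast
      define \<gamma> where "\<gamma> s = (\<lambda>v. x v + s * u v)" for s
      have \<gamma>0: "\<gamma> 0 = x" by (simp add: \<gamma>_def)
      have dy: "((\<lambda>s. y k (\<gamma> s)) has_real_derivative 0) (at 0)" if "k \<in> ?K" for k
        using that
      proof (rule PlusE)
        fix i assume "i \<in> I" "k = Inl i"
        then show ?thesis using deriv[of i x u] du[of i] by (simp add: y_def \<gamma>_def)
      next
        fix t assume "t \<in> T" "k = Inr t"
        then show ?thesis using uT[of t] by (simp add: y_def \<gamma>_def)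
      qed
      have dF: "((\<lambda>s. F j l (\<gamma> s)) has_real_derivative 0) (at 0)" for j l
      proof -
        have "((\<lambda>s. \<Prod>i\<in>A. y i (\<gamma> s) ^ t i) has_real_derivative 0) (at 0)"
          if "finite A" "A \<subseteq> ?K" for A t
          using that
        proof (induction rule: finite_induct)
          case (insert a A)
          have "((\<lambda>s. y a (\<gamma> s) ^ t a) has_real_derivative 0) (at 0)"
            using DERIV_power[OF dy[of a], of "t a"] insert.prems by simp
          from DERIV_mult[OF this insert.IH] insert show ?case by simp
        qed simp
        from DERIV_cmult[OF this[OF fK order.refl]]
        have "((\<lambda>s. c j l t * (\<Prod>i\<in>?K. y i (\<gamma> s) ^ t i)) has_real_derivative 0) (at 0)" for t
          by simp
        from DERIV_sum[of "exps ?K (d j)" _ "\<lambda>_. 0", OF this] show ?thesis unfolding F_def by simp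
      qed
      \<comment> \<open>In the derivative of the relation of \<open>j\<close> along
        \<open>\<gamma>\<close> at 0 the coefficients are stationary, so only
        \<open>g j x * u j\<close> is left.\<close>
      have "u j = 0" if j: "j \<in> V - T" for j
      proof -
        have dx: "((\<lambda>s. \<gamma> s j) has_real_derivative u j) (at 0)"
          unfolding \<gamma>_def by (auto intro!: derivative_eq_intros)
        have "((\<lambda>s. \<Sum>l\<le>N j. F j l (\<gamma> s) * \<gamma> s j ^ l) has_real_derivative
          (\<Sum>l\<le>N j. F j l x * (real l * (u j * x j ^ (l - 1))))) (at 0)"
        proof (rule DERIV_sum)
          fix l
          from DERIV_mult[OF dF[of j l] DERIV_power[OF dx, of l]]
          show "((\<lambda>s. F j l (\<gamma> s) * \<gamma> s j ^ l) has_real_derivative F j l x * (real l * (u j * x j ^ (l - 1)))) (at 0)"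
            by (simp add: \<gamma>0 mult_ac)
        qed
        moreover have "(\<lambda>s. \<Sum>l\<le>N j. F j l (\<gamma> s) * \<gamma> s j ^ l) = (\<lambda>_. 0)"
          using rel[OF j] by (auto simp: F_def y_def)
        ultimately have "(\<Sum>l\<le>N j. F j l x * (real l * (u j * x j ^ (l - 1)))) = 0"
          using DERIV_unique[OF _ DERIV_const] by fastforce
        moreover have "g j x * u j = (\<Sum>l\<le>N j. F j l x * (real l * (u j * x j ^ (l - 1))))"
          unfolding g_def sum_distrib_right by (intro sum.cong) (auto simp: mult_ac)
        ultimately have "g j x * u j = 0" by simp
        with nz j show ?thesis by simp
      qed
      with uT u(1) show False by blast
    qed
  qed
qed

subsection \<open>Evaluation of polynomials\<close>

definition monom_eval :: "('v \<Rightarrow> real) \<Rightarrow> ('v \<Rightarrow>\<^sub>0 nat) \<Rightarrow> real" where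
  "monom_eval x t = (\<Prod>v\<in>Poly_Mapping.keys t. x v ^ Poly_Mapping.lookup t v)"

definition mpoly_eval :: "('v \<Rightarrow> real) \<Rightarrow> 'v mpoly \<Rightarrow> real" where
  "mpoly_eval x p = (\<Sum>t\<in>Poly_Mapping.keys p. Poly_Mapping.lookup p t * monom_eval x t)"

lemma monom_eval_superset:
  assumes "finite V" and "Poly_Mapping.keys t \<subseteq> V"
  shows "monom_eval x t = (\<Prod>v\<in>V. x v ^ Poly_Mapping.lookup t v)"
  unfolding monom_eval_def using assms
  by (intro prod.mono_neutral_left) (auto simp: in_keys_iff)

lemma mpoly_eval_superset:
  assumes "finite K" and "Poly_Mapping.keys p \<subseteq> K"
  shows "mpoly_eval x p = (\<Sum>t\<in>K. Poly_Mapping.lookup p t * monom_eval x t)"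
  unfolding mpoly_eval_def using assms
  by (intro sum.mono_neutral_left) (auto simp: in_keys_iff)

lemma monom_eval_add: "monom_eval x (s + t) = monom_eval x s * monom_eval x t"
proof -
  let ?V = "Poly_Mapping.keys s \<union> Poly_Mapping.keys t"
  show ?thesis
    using Poly_Mapping.keys_add[of s t]
    by (subst (1 2 3) monom_eval_superset[of ?V]) (auto simp: lookup_add power_add prod.distrib)
qed

lemma monom_eval_0 [simp]: "monom_eval x 0 = 1"
  by (simp add: monom_eval_def)

lemma mpoly_eval_single: "mpoly_eval x (Poly_Mapping.single t c) = c * monom_eval x t"
  by (subst mpoly_eval_superset[of "{t}"]) auto

lemma mpoly_eval_add: "mpoly_eval x (p + q) = mpoly_eval x p + mpoly_eval x q"
proof -
  let ?K = "Poly_Mapping.keys p \<union> Poly_Mapping.keys q"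
  show ?thesis
    using Poly_Mapping.keys_add[of p q]
    by (subst (1 2 3) mpoly_eval_superset[of ?K]) (auto simp: lookup_add algebra_simps sum.distrib)
qed

lemma mpoly_eval_0: "mpoly_eval x 0 = 0"
  by (simp add: mpoly_eval_def)

lemma mpoly_eval_sum: "mpoly_eval x (\<Sum>i\<in>I. p i) = (\<Sum>i\<in>I. mpoly_eval x (p i))"
  by (induction I rule: infinite_finite_induct) (auto simp: mpoly_eval_0 mpoly_eval_add)

lemma mpoly_sum_single:
  "p = (\<Sum>t\<in>Poly_Mapping.keys p. Poly_Mapping.single t (Poly_Mapping.lookup p t))"
  by (rule poly_mapping_eqI) (auto simp: lookup_sum lookup_single when_def in_keys_iff)

lemma mpoly_eval_mult: "mpoly_eval x (p * q) = mpoly_eval x p * mpoly_eval x q"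
proof -
  have "p * q = (\<Sum>s\<in>Poly_Mapping.keys p. Poly_Mapping.single s (Poly_Mapping.lookup p s)) *
      (\<Sum>t\<in>Poly_Mapping.keys q. Poly_Mapping.single t (Poly_Mapping.lookup q t))"
    by (metis mpoly_sum_single)
  also have "\<dots> = (\<Sum>s\<in>Poly_Mapping.keys p. \<Sum>t\<in>Poly_Mapping.keys q.
      Poly_Mapping.single (s + t) (Poly_Mapping.lookup p s * Poly_Mapping.lookup q t))"
    by (simp add: sum_product mult_single)
  finally show ?thesis
    by (simp add: mpoly_eval_sum mpoly_eval_single monom_eval_add)
       (simp add: mpoly_eval_def sum_product mult_ac)
qed

lemma mpoly_eval_1: "mpoly_eval x 1 = 1"
  by (simp add: mpoly_eval_single flip: single_one)

interpretation mpoly_eval: comm_ring_hom "mpoly_eval x" for x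
  by unfold_locales (simp_all add: mpoly_eval_0 mpoly_eval_1 mpoly_eval_add mpoly_eval_mult)

abbreviation var :: "'v \<Rightarrow> 'v mpoly" where
  "var v \<equiv> Poly_Mapping.single (Poly_Mapping.single v 1) 1"

lemma mpoly_eval_var: "mpoly_eval x (var v) = x v"
  by (simp add: mpoly_eval_single monom_eval_def)

lemma prod_var_power:
  "finite A \<Longrightarrow> (\<Prod>v\<in>A. var v ^ k v) = Poly_Mapping.single (\<Sum>v\<in>A. Poly_Mapping.single v (k v)) 1"
proof (induction rule: finite_induct)
  case (insert a A)
  have "var a ^ l = Poly_Mapping.single (Poly_Mapping.single a l) 1" for l
    by (induction l) (simp_all add: mult_single flip: single_add)
  with insert show ?case by (simp add: mult_single)
qed simp

lemma poly_mapping_sum_single_nat: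
  "t = (\<Sum>v\<in>Poly_Mapping.keys t. Poly_Mapping.single v (Poly_Mapping.lookup t v :: nat))"
  by (rule poly_mapping_eqI) (auto simp: lookup_sum lookup_single when_def in_keys_iff)

text \<open>Builds \<open>p\<close> by ring operations from constants and variables, the form in
  which a substitution can be carried out modulo an ideal.\<close>

lemma mpoly_expand:
  "p = (\<Sum>t\<in>Poly_Mapping.keys p. Poly_Mapping.single 0 (Poly_Mapping.lookup p t) *
     (\<Prod>v\<in>Poly_Mapping.keys t. var v ^ Poly_Mapping.lookup t v))"
proof -
  have "Poly_Mapping.single 0 (Poly_Mapping.lookup p t) *
     (\<Prod>v\<in>Poly_Mapping.keys t. var v ^ Poly_Mapping.lookup t v) =
     Poly_Mapping.single t (Poly_Mapping.lookup p t)" for t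
    by (simp only: prod_var_power[OF finite_keys] mult_single poly_mapping_sum_single_nat[symmetric] add_0_left mult_1_right)
  then show ?thesis by (simp flip: mpoly_sum_single)
qed

text \<open>Induction on the variables. The slice of terms with exponent \<open>t0 w\<close> in the
  new variable is nonzero at some grid point; there the whole sum is a nonzero univariate polynomial
  in the new coordinate, and the infinite set \<open>Z w\<close> contains a non-root. The grid
  depends on the variable because diagonal and off-diagonal matrix entries will be confined to
  different sets.\<close>

lemma nonvanishing_on_grid:
  fixes c :: "('v \<Rightarrow> nat) \<Rightarrow> real"
  assumes "finite V" and "finite T" and "t0 \<in> T" and "c t0 \<noteq> 0"
    and "\<And>t t'. t \<in> T \<Longrightarrow> t' \<in> T \<Longrightarrow> (\<And>v. v \<in> V \<Longrightarrow> t v = t' v) \<Longrightarrow> t = t'"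
    and Z: "\<And>v. infinite (Z v)"
  shows "\<exists>x. (\<forall>v. x v \<in> Z v) \<and> (\<Sum>t\<in>T. c t * (\<Prod>v\<in>V. x v ^ t v)) \<noteq> 0"
  using assms(1-5)
proof (induction V arbitrary: T rule: finite_induct)
  case empty
  have "T = {t0}" using empty by blast
  moreover have "\<forall>v. \<exists>z. z \<in> Z v" using Z by (metis ex_in_conv finite.emptyI)
  then obtain x where "\<And>v. x v \<in> Z v" by metis
  ultimately show ?case using empty by (intro exI[of _ x]) auto
next
  case (insert w V)
  define T' where "T' l = {t \<in> T. t w = l}" for l
  have "\<exists>x. (\<forall>v. x v \<in> Z v) \<and> (\<Sum>t\<in>T' (t0 w). c t * (\<Prod>v\<in>V. x v ^ t v)) \<noteq> 0"
  proof (rule insert.IH)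
    fix t t' assume "t \<in> T' (t0 w)" "t' \<in> T' (t0 w)" "\<And>v. v \<in> V \<Longrightarrow> t v = t' v"
    then show "t = t'" by (intro insert.prems(4)) (auto simp: T'_def)
  qed (use insert.prems in \<open>auto simp: T'_def\<close>)
  then obtain x where x: "\<And>v. x v \<in> Z v" "(\<Sum>t\<in>T' (t0 w). c t * (\<Prod>v\<in>V. x v ^ t v)) \<noteq> 0" by blast
  define N where "N = Max ((\<lambda>t. t w) ` T)"
  have N: "t w \<le> N" if "t \<in> T" for t using that insert.prems unfolding N_def by auto
  define q where "q = (\<Sum>l\<le>N. Polynomial.monom (\<Sum>t\<in>T' l. c t * (\<Prod>v\<in>V. x v ^ t v)) l)"
  have "poly.coeff q (t0 w) = (\<Sum>t\<in>T' (t0 w). c t * (\<Prod>v\<in>V. x v ^ t v))"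
    using N[OF insert.prems(2)] by (simp add: q_def coeff_sum)
  with x(2) have "q \<noteq> 0" by auto
  then have "finite {s. poly q s = 0}" by (rule poly_roots_finite)
  then have "infinite (Z w - {s. poly q s = 0})" using Z by simp
  then obtain s where s: "s \<in> Z w" "poly q s \<noteq> 0" by (metis (mono_tags, lifting) Diff_iff finite.emptyI mem_Collect_eq ex_in_conv)
  have "(\<Sum>t\<in>T. c t * (\<Prod>v\<in>insert w V. (x(w := s)) v ^ t v))
      = (\<Sum>l\<le>N. \<Sum>t\<in>T' l. c t * (\<Prod>v\<in>insert w V. (x(w := s)) v ^ t v))"
    unfolding T'_def by (rule sum.group[symmetric]) (use insert.prems N in auto)
  also have "\<dots> = (\<Sum>l\<le>N. (\<Sum>t\<in>T' l. c t * (\<Prod>v\<in>V. x v ^ t v)) * s ^ l)"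
    unfolding sum_distrib_right
  proof (intro sum.cong refl)
    fix l t assume t: "t \<in> T' l"
    have "(\<Prod>v\<in>V. (x(w := s)) v ^ t v) = (\<Prod>v\<in>V. x v ^ t v)"
      using insert.hyps by (intro prod.cong) auto
    with t insert.hyps show "c t * (\<Prod>v\<in>insert w V. (x(w := s)) v ^ t v) = c t * (\<Prod>v\<in>V. x v ^ t v) * s ^ l"
      by (simp add: T'_def)
  qed
  also have "\<dots> = poly q s" by (simp add: q_def poly_sum poly_monom)
  finally show ?case using s x(1) by (intro exI[of _ "x(w := s)"]) auto
qed

lemma mpoly_eq_0I:
  fixes p :: "'v mpoly"
  assumes V: "finite (UNIV :: 'v set)" and Z: "\<And>v. infinite (Z v)"
    and p: "\<And>x. (\<And>v. x v \<in> Z v) \<Longrightarrow> mpoly_eval x p = 0"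
  shows "p = 0"
proof (rule ccontr)
  assume "p \<noteq> 0"
  then obtain t0 where t0: "t0 \<in> Poly_Mapping.keys p"
    by (metis poly_mapping_eqI in_keys_iff lookup_zero)
  let ?T = "Poly_Mapping.lookup ` Poly_Mapping.keys p"
  have inj: "inj Poly_Mapping.lookup" by (rule injI) (simp only: lookup_inject)
  have "\<exists>x. (\<forall>v. x v \<in> Z v) \<and>
      (\<Sum>t\<in>?T. Poly_Mapping.lookup p (Abs_poly_mapping t) * (\<Prod>v\<in>UNIV. x v ^ t v)) \<noteq> 0"
    by (rule nonvanishing_on_grid[OF V, of _ "Poly_Mapping.lookup t0"])
       (use t0 Z in \<open>auto simp: in_keys_iff lookup_inverse\<close>)
  then obtain x where x: "\<And>v. x v \<in> Z v"
    "(\<Sum>t\<in>?T. Poly_Mapping.lookup p (Abs_poly_mapping t) * (\<Prod>v\<in>UNIV. x v ^ t v)) \<noteq> 0" by blast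
  have "(\<Sum>t\<in>?T. Poly_Mapping.lookup p (Abs_poly_mapping t) * (\<Prod>v\<in>UNIV. x v ^ t v)) = mpoly_eval x p"
    unfolding mpoly_eval_def
    by (subst sum.reindex) (auto simp: lookup_inverse monom_eval_superset[OF V] intro: inj_on_subset[OF inj])
  with p[OF x(1)] x(2) show False by simp
qed

lemma mpoly_vars_mult: "mpoly_vars (p * q) \<subseteq> mpoly_vars p \<union> mpoly_vars q"
proof
  fix v assume "v \<in> mpoly_vars (p * q)"
  then obtain t where t: "t \<in> Poly_Mapping.keys (p * q)" "v \<in> Poly_Mapping.keys t"
    by (auto simp: mpoly_vars_def)
  then obtain a b where "t = a + b" "a \<in> Poly_Mapping.keys p" "b \<in> Poly_Mapping.keys q"
    using keys_mult[of p q] by auto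
  with t(2) Poly_Mapping.keys_add[of a b] show "v \<in> mpoly_vars p \<union> mpoly_vars q"
    by (auto simp: mpoly_vars_def)
qed

lemma edge_subring_power: "p \<in> edge_subring E \<Longrightarrow> p ^ k \<in> edge_subring E"
proof (induction k)
  case 0
  then show ?case by (simp add: edge_subring_def mpoly_vars_def)
next
  case (Suc k)
  then show ?case using mpoly_vars_mult[of p "p ^ k"] by (auto simp: edge_subring_def)
qed

subsection \<open>Prime ideals\<close>

definition is_ideal :: "'a::comm_ring_1 set \<Rightarrow> bool" where
  "is_ideal P \<longleftrightarrow> 0 \<in> P \<and> (\<forall>a\<in>P. \<forall>b\<in>P. a + b \<in> P) \<and> (\<forall>r. \<forall>a\<in>P. r * a \<in> P)"

definition is_prime_ideal :: "'a::comm_ring_1 set \<Rightarrow> bool" where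
  "is_prime_ideal P \<longleftrightarrow> is_ideal P \<and> 1 \<notin> P \<and> (\<forall>a b. a * b \<in> P \<longrightarrow> a \<in> P \<or> b \<in> P)"

lemma is_idealD:
  assumes "is_ideal P"
  shows "0 \<in> P" and "a \<in> P \<Longrightarrow> b \<in> P \<Longrightarrow> a + b \<in> P" and "a \<in> P \<Longrightarrow> r * a \<in> P"
    and "a \<in> P \<Longrightarrow> a * r \<in> P" and "a \<in> P \<Longrightarrow> - a \<in> P" and "a \<in> P \<Longrightarrow> b \<in> P \<Longrightarrow> a - b \<in> P"
proof -
  note P = assms[unfolded is_ideal_def]
  show "0 \<in> P" and add: "a \<in> P \<Longrightarrow> b \<in> P \<Longrightarrow> a + b \<in> P" and "a \<in> P \<Longrightarrow> r * a \<in> P" for a b r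
    using P by auto
  then show "a \<in> P \<Longrightarrow> a * r \<in> P" by (simp add: mult.commute)
  have "-1 * a \<in> P" if "a \<in> P" for a using that P by blast
  then show m: "a \<in> P \<Longrightarrow> - a \<in> P" for a by simp
  show "a \<in> P \<Longrightarrow> b \<in> P \<Longrightarrow> a - b \<in> P" using add[OF _ m, of a b] by simp
qed

lemma is_ideal_sum:
  assumes "is_ideal P" and "\<And>i. i \<in> I \<Longrightarrow> a i \<in> P" shows "(\<Sum>i\<in>I. a i) \<in> P"
  using assms(2) by (induction I rule: infinite_finite_induct) (auto intro: is_idealD[OF assms(1)])

lemma is_prime_ideal_power:
  assumes "is_prime_ideal P" and "a ^ k \<in> P" shows "a \<in> P"
  using assms(2) by (induction k) (use assms(1) in \<open>auto simp: is_prime_ideal_def\<close>)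

lemma is_ideal_generated: "is_ideal (ideal_generated B)"
  and ideal_generated_superset: "B \<subseteq> ideal_generated B"
proof -
  interpret Modules.module "(*) :: 'a \<Rightarrow> 'a \<Rightarrow> 'a" by (rule module_times)
  show "is_ideal (ideal_generated B)" unfolding is_ideal_def ideal_generated_def
    by (auto intro: span_zero span_add span_scale)
  show "B \<subseteq> ideal_generated B" unfolding ideal_generated_def by (rule span_superset)
qed

text \<open>An ideal that is maximal among those containing \<open>J\<close> but no power of
  \<open>f\<close> is prime. This is the nontrivial half of the fact that the radical is the
  intersection of the primes above \<open>J\<close>.\<close>

lemma prime_ideal_avoiding_powers:
  fixes f :: "'a::comm_ring_1"
  assumes J: "is_ideal J" and f: "\<And>k. f ^ k \<notin> J"
  obtains P where "is_prime_ideal P" and "J \<subseteq> P" and "f \<notin> P"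
proof -
  let ?\<A> = "{P. is_ideal P \<and> J \<subseteq> P \<and> (\<forall>k. f ^ k \<notin> P)}"
  have "\<exists>P\<in>?\<A>. \<forall>Q\<in>?\<A>. P \<subseteq> Q \<longrightarrow> Q = P"
  proof (rule subset_Zorn_nonempty)
    show "?\<A> \<noteq> {}" using assms by blast
    fix \<C> assume \<C>: "\<C> \<noteq> {}" "subset.chain ?\<A> \<C>"
    then have mem: "\<And>P. P \<in> \<C> \<Longrightarrow> P \<in> ?\<A>" and lin: "\<And>P Q. P \<in> \<C> \<Longrightarrow> Q \<in> \<C> \<Longrightarrow> P \<subseteq> Q \<or> Q \<subseteq> P"
      by (auto simp: subset_chain_def)
    have "is_ideal (\<Union>\<C>)"
      unfolding is_ideal_def
    proof (intro conjI allI ballI)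
      show "0 \<in> \<Union>\<C>" using \<C>(1) mem is_idealD(1) by blast
      fix a b assume "a \<in> \<Union>\<C>" "b \<in> \<Union>\<C>"
      then obtain P Q where PQ: "P \<in> \<C>" "a \<in> P" "Q \<in> \<C>" "b \<in> Q" by blast
      with lin[of P Q] obtain R where "R \<in> \<C>" "a \<in> R" "b \<in> R" by blast
      with mem[of R] show "a + b \<in> \<Union>\<C>" using is_idealD(2) by blast
    next
      fix r a assume "a \<in> \<Union>\<C>"
      then show "r * a \<in> \<Union>\<C>" using mem is_idealD(3) by blast
    qed
    then show "\<Union>\<C> \<in> ?\<A>" using \<C>(1) mem by blast
  qed
  then obtain P where PA: "P \<in> ?\<A>" and PQ: "\<forall>Q\<in>?\<A>. P \<subseteq> Q \<longrightarrow> Q = P" ..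
  from PA have P: "is_ideal P" "J \<subseteq> P" "\<And>k. f ^ k \<notin> P" by auto
  have max: "Q = P" if "is_ideal Q" "P \<subseteq> Q" "\<And>k. f ^ k \<notin> Q" for Q
    using bspec[OF PQ, of Q] P(2) that by auto
  note ideal = is_idealD[OF P(1)]
  \<comment> \<open>Otherwise the ideal generated by \<open>P\<close> and \<open>a\<close> would be
    a larger one avoiding all powers of \<open>f\<close>. Multiplying two such representations
    yields primality below.\<close>
  have ex: "\<exists>k p r. f ^ k = p + r * a \<and> p \<in> P" if a: "a \<notin> P" for a
  proof (rule ccontr)
    assume no: "\<not> (\<exists>k p r. f ^ k = p + r * a \<and> p \<in> P)"
    let ?Q = "{p + r * a | p r. p \<in> P}"
    have PQ: "P \<subseteq> ?Q"
    proof
      fix p assume "p \<in> P"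
      moreover have "p = p + 0 * a" by simp
      ultimately show "p \<in> ?Q" by blast
    qed
    moreover have "is_ideal ?Q"
      unfolding is_ideal_def
    proof (intro conjI allI ballI)
      show "0 \<in> ?Q" using PQ ideal(1) by blast
      fix b c assume "b \<in> ?Q" "c \<in> ?Q"
      then obtain p r p' r' where "b = p + r * a" "c = p' + r' * a" "p \<in> P" "p' \<in> P" by blast
      then have "b + c = (p + p') + (r + r') * a" "p + p' \<in> P" by (auto simp: algebra_simps ideal)
      then show "b + c \<in> ?Q" by blast
    next
      fix s b assume "b \<in> ?Q"
      then obtain p r where "b = p + r * a" "p \<in> P" by blast
      then have "s * b = s * p + (s * r) * a" "s * p \<in> P" by (auto simp: algebra_simps ideal)
      then show "s * b \<in> ?Q" by blast
    qed
    ultimately have "?Q = P" using no by (intro max) auto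
    moreover have "a = 0 + 1 * a" by simp
    then have "a \<in> ?Q" using ideal(1) by blast
    ultimately show False using a by simp
  qed
  have "a \<in> P \<or> b \<in> P" if ab: "a * b \<in> P" for a b
  proof (rule ccontr)
    assume "\<not> ?thesis"
    with ex[of a] ex[of b] obtain k p r l q s where
      *: "f ^ k = p + r * a" "p \<in> P" "f ^ l = q + s * b" "q \<in> P" by blast
    have "f ^ (k + l) = p * (q + s * b) + (r * a) * q + (r * s) * (a * b)"
      by (simp add: power_add * algebra_simps)
    also have "\<dots> \<in> P" by (rule ideal(2)[OF ideal(2)[OF ideal(4)[OF *(2)] ideal(3)[OF *(4)]] ideal(3)[OF ab]])
    finally show False using P(3) by blast
  qed
  then have "is_prime_ideal P"
    unfolding is_prime_ideal_def using P(1) P(3)[of 0] by auto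
  with P(2) P(3)[of 1] that show thesis by simp
qed

text \<open>
  Substitutes \<open>U v / d\<close> for every variable modulo \<open>P\<close>, with the denominators cleared by \<open>d ^ N\<close>.
\<close>

lemma mpoly_homogeneous_substitution:
  fixes p :: "'v mpoly"
  assumes P: "is_ideal P" and U: "\<And>v. d * var v - U v \<in> P"
  obtains N where "d ^ N * p - (\<Sum>t\<in>Poly_Mapping.keys p. Poly_Mapping.single 0 (Poly_Mapping.lookup p t) *
     d ^ (N - (\<Sum>v\<in>Poly_Mapping.keys t. Poly_Mapping.lookup t v)) *
     (\<Prod>v\<in>Poly_Mapping.keys t. U v ^ Poly_Mapping.lookup t v)) \<in> P"
    and "\<And>t. t \<in> Poly_Mapping.keys p \<Longrightarrow> (\<Sum>v\<in>Poly_Mapping.keys t. Poly_Mapping.lookup t v) \<le> N"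
proof -
  note ideal = is_idealD[OF P]
  define deg where "deg t = (\<Sum>v\<in>Poly_Mapping.keys t. Poly_Mapping.lookup t v :: nat)" for t :: "'v \<Rightarrow>\<^sub>0 nat"
  define N where "N = Max (deg ` Poly_Mapping.keys p)"
  have N: "deg t \<le> N" if "t \<in> Poly_Mapping.keys p" for t using that by (auto simp: N_def)
  have mult: "a * b - a' * b' \<in> P" if "a - a' \<in> P" "b - b' \<in> P" for a a' b b'
  proof -
    have "a * b - a' * b' = (a - a') * b + a' * (b - b')" by (simp add: algebra_simps)
    then show ?thesis using that by (auto intro: ideal)
  qed
  have pow: "a ^ k - b ^ k \<in> P" if "a - b \<in> P" for a b k
    by (induction k) (auto intro: mult that ideal)
  have prod: "(\<Prod>v\<in>A. (d * var v) ^ k v) - (\<Prod>v\<in>A. U v ^ k v) \<in> P" for A k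
  proof (induction A rule: infinite_finite_induct)
    case (insert a A)
    show ?case unfolding prod.insert[OF insert.hyps] by (intro mult pow U insert.IH)
  qed (auto intro: ideal)
  let ?C = "\<lambda>t. Poly_Mapping.single 0 (Poly_Mapping.lookup p t)"
  have "d ^ N * p = (\<Sum>t\<in>Poly_Mapping.keys p. d ^ N * (?C t * (\<Prod>v\<in>Poly_Mapping.keys t. var v ^ Poly_Mapping.lookup t v)))"
    by (subst mpoly_expand[of p]) (simp add: sum_distrib_left)
  also have "\<dots> = (\<Sum>t\<in>Poly_Mapping.keys p. ?C t * d ^ (N - deg t) * (\<Prod>v\<in>Poly_Mapping.keys t. (d * var v) ^ Poly_Mapping.lookup t v))"
  proof (intro sum.cong refl)
    fix t assume "t \<in> Poly_Mapping.keys p"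
    then have "d ^ N = d ^ (N - deg t) * d ^ deg t" using N by (simp flip: power_add)
    also have "d ^ deg t = (\<Prod>v\<in>Poly_Mapping.keys t. d ^ Poly_Mapping.lookup t v)"
      by (simp add: deg_def power_sum)
    finally show "d ^ N * (?C t * (\<Prod>v\<in>Poly_Mapping.keys t. var v ^ Poly_Mapping.lookup t v)) =
      ?C t * d ^ (N - deg t) * (\<Prod>v\<in>Poly_Mapping.keys t. (d * var v) ^ Poly_Mapping.lookup t v)"
      by (simp only: power_mult_distrib prod.distrib mult_ac)
  qed
  finally have "d ^ N * p - (\<Sum>t\<in>Poly_Mapping.keys p. ?C t * d ^ (N - deg t) * (\<Prod>v\<in>Poly_Mapping.keys t. U v ^ Poly_Mapping.lookup t v))
    = (\<Sum>t\<in>Poly_Mapping.keys p. ?C t * d ^ (N - deg t) *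
       ((\<Prod>v\<in>Poly_Mapping.keys t. (d * var v) ^ Poly_Mapping.lookup t v) - (\<Prod>v\<in>Poly_Mapping.keys t. U v ^ Poly_Mapping.lookup t v)))"
    by (simp add: sum_subtractf right_diff_distrib)
  also have "\<dots> \<in> P" by (intro is_ideal_sum[OF P] ideal prod)
  finally show thesis using that N unfolding deg_def by blast
qed

subsection \<open>Symmetric matrices of low rank\<close>

lemma adj_mat_transpose:
  assumes "A \<in> carrier_mat n n"
  shows "adj_mat (transpose_mat A) = transpose_mat (adj_mat A)"
proof (rule eq_matI)
  fix i j assume ij: "i < dim_row (transpose_mat (adj_mat A))" "j < dim_col (transpose_mat (adj_mat A))"
  have del: "mat_delete (transpose_mat A) j i = transpose_mat (mat_delete A i j)"
    by (rule eq_matI) (use assms ij in \<open>auto simp: mat_delete_def adj_mat_def\<close>)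
  have "Determinant.det (mat_delete (transpose_mat A) j i) = Determinant.det (mat_delete A i j)"
    unfolding del using assms by (intro Determinant.det_transpose[of _ "n - 1"]) (auto simp: mat_delete_def)
  then show "adj_mat (transpose_mat A) $$ (i, j) = transpose_mat (adj_mat A) $$ (i, j)"
    using assms ij by (auto simp: adj_mat_def cofactor_def add.commute)
qed (use assms in \<open>auto simp: adj_mat_def\<close>)

text \<open>
  A version of the Schur complement formula over an arbitrary commutative ring: \<open>Q\<close> is \<open>det A\<close> times the
  Schur complement.
\<close>

lemma det_bordered_dvd:
  fixes A :: "'a::comm_ring_1 Matrix.mat"
  assumes A: "A \<in> carrier_mat k k" and B: "B \<in> carrier_mat k l"
    and C: "C \<in> carrier_mat l k" and D: "D \<in> carrier_mat l l"
  defines "Q \<equiv> Determinant.det A \<cdot>\<^sub>m D - C * (adj_mat A * B)"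
  shows "Determinant.det (four_block_mat A B C D) dvd Determinant.det A ^ k * Determinant.det Q ^ l"
proof -
  let ?d = "Determinant.det A" and ?A' = "adj_mat A" and ?Q' = "adj_mat Q"
  note A' = adj_mat[OF A]
  have Q: "Q \<in> carrier_mat l l" using A' B C D unfolding Q_def by auto
  note Q' = adj_mat[OF Q]
  define X where "X = ?A' * (B * ?Q')"
  have X: "X \<in> carrier_mat k l" using A' B Q' unfolding X_def by auto
  \<comment> \<open>Denominator-free block elimination: \<open>?R\<close> clears the upper right
    block and leaves \<open>det Q\<close> times the identity below it, and \<open>?L\<close> turns
    \<open>A\<close> into \<open>det A\<close> times the identity. The product is triangular, and
    its determinant is a multiple of that of \<open>?M\<close>.\<close>
  let ?L = "four_block_mat ?A' (0\<^sub>m k l) (0\<^sub>m l k) (1\<^sub>m l)"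
  let ?R = "four_block_mat (1\<^sub>m k) (- X) (0\<^sub>m l k) (?d \<cdot>\<^sub>m ?Q')"
  let ?M = "four_block_mat A B C D"
  have "A * X = (A * ?A') * (B * ?Q')"
    unfolding X_def by (rule assoc_mult_mat[symmetric, OF A A'(1) mult_carrier_mat[OF B Q'(1)]])
  also have "\<dots> = B * (?d \<cdot>\<^sub>m ?Q')"
    using A' B Q' by (simp add: mult_smult_distrib[OF B] mult_smult_assoc_mat[of "1\<^sub>m k" k k "B * adj_mat Q" l])
  finally have AX: "A * (- X) + B * (?d \<cdot>\<^sub>m ?Q') = 0\<^sub>m k l"
    using A X B Q' by (intro eq_matI) auto
  have CX: "C * X = (C * (?A' * B)) * ?Q'"
    unfolding X_def
    by (simp only: assoc_mult_mat[OF A'(1) B Q'(1), symmetric]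
        assoc_mult_mat[OF C mult_carrier_mat[OF A'(1) B] Q'(1)])
  have "D * (?d \<cdot>\<^sub>m ?Q') = (?d \<cdot>\<^sub>m D) * ?Q'"
    by (simp add: mult_smult_distrib[OF D Q'(1)] mult_smult_assoc_mat[OF D Q'(1)])
  then have "C * (- X) + D * (?d \<cdot>\<^sub>m ?Q') = Q * ?Q'"
    using C X D Q' A' B CX unfolding Q_def by (subst minus_mult_distrib_mat) (auto intro!: eq_matI)
  with Q' have CX: "C * (- X) + D * (?d \<cdot>\<^sub>m ?Q') = Determinant.det Q \<cdot>\<^sub>m 1\<^sub>m l" by simp
  have MR: "?M * ?R = four_block_mat A (0\<^sub>m k l) C (Determinant.det Q \<cdot>\<^sub>m 1\<^sub>m l)"
  proof -
    have "?M * ?R = four_block_mat (A * 1\<^sub>m k + B * 0\<^sub>m l k) (A * (- X) + B * (?d \<cdot>\<^sub>m ?Q'))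
      (C * 1\<^sub>m k + D * 0\<^sub>m l k) (C * (- X) + D * (?d \<cdot>\<^sub>m ?Q'))"
      by (rule mult_four_block_mat[OF A B C D]) (use X Q' in auto)
    then show ?thesis unfolding AX CX using A B C D by simp
  qed
  have LMR: "?L * (?M * ?R) = four_block_mat (?d \<cdot>\<^sub>m 1\<^sub>m k) (0\<^sub>m k l) C (Determinant.det Q \<cdot>\<^sub>m 1\<^sub>m l)"
    unfolding MR using A A' C by (subst mult_four_block_mat) auto
  let ?T = "four_block_mat (?d \<cdot>\<^sub>m 1\<^sub>m k) (0\<^sub>m k l) C (Determinant.det Q \<cdot>\<^sub>m 1\<^sub>m l)"
  have T: "?T \<in> carrier_mat (k + l) (k + l)" using C by simp
  have "Determinant.det ?T = prod_list (diag_mat ?T)"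
    using C by (intro Determinant.det_lower_triangular[OF _ T]) auto
  also have "\<dots> = (\<Prod>i = 0..<k + l. ?T $$ (i, i))"
    using T by (simp add: prod_list_diag_prod)
  also have "\<dots> = (\<Prod>i = 0..<k + l. if i < k then ?d else Determinant.det Q)"
    using C by (intro prod.cong) auto
  also have "\<dots> = ?d ^ k * Determinant.det Q ^ l"
  proof -
    have "{0..<k + l} = {0..<k} \<union> {k..<k + l}" by auto
    then have "(\<Prod>i = 0..<k + l. if i < k then ?d else Determinant.det Q)
      = (\<Prod>i = 0..<k. if i < k then ?d else Determinant.det Q) * (\<Prod>i = k..<k + l. if i < k then ?d else Determinant.det Q)"
      by (simp add: prod.union_disjoint)
    also have "\<dots> = (\<Prod>i = 0..<k. ?d) * (\<Prod>i = k..<k + l. Determinant.det Q)"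
      by (intro arg_cong2[of _ _ _ _ "(*)"] prod.cong) auto
    finally show ?thesis by simp
  qed
  finally have det: "?d ^ k * Determinant.det Q ^ l = Determinant.det (?L * (?M * ?R))"
    unfolding LMR by simp
  have L: "?L \<in> carrier_mat (k + l) (k + l)" "?M \<in> carrier_mat (k + l) (k + l)" "?R \<in> carrier_mat (k + l) (k + l)"
    using A A' B C D X Q' by auto
  then have "Determinant.det (?L * (?M * ?R)) = Determinant.det ?M * (Determinant.det ?L * Determinant.det ?R)"
    by (simp add: Determinant.det_mult[of _ "k + l"] mult_ac)
  then show ?thesis unfolding det by simp
qed

lemma det_mat_2:
  fixes A :: "'a::comm_ring_1 Matrix.mat"
  assumes A: "A \<in> carrier_mat 2 2"
  shows "Determinant.det A = A $$ (0, 0) * A $$ (1, 1) - A $$ (0, 1) * A $$ (1, 0)"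
proof -
  have single: "Determinant.det (mat_delete A i 0) = A $$ (1 - i, 1)" if "i < 2" for i
    using A that by (subst det_single) (auto simp: mat_delete_def less_2_cases_iff)
  have "Determinant.det A = (\<Sum>i<2. A $$ (i, 0) * cofactor A i 0)"
    by (rule laplace_expansion_column[OF A]) simp
  also have "\<dots> = A $$ (0, 0) * cofactor A 0 0 + A $$ (1, 0) * cofactor A 1 0"
    by (simp add: numeral_2_eq_2)
  finally show ?thesis by (simp add: cofactor_def single algebra_simps)
qed

text \<open>
  Choose a principal minor \<open>d \<notin> P\<close> of maximal size \<open>k \<le> n\<close>. The bordered minors \<open>q i j\<close> vanish modulo \<open>P\<close>: on the
  diagonal by maximality, and off the diagonal because the principal minor with both borders gives
  \<open>q i i * q j j - (q i j)\<^sup>2 \<in> P\<close>.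
\<close>

lemma low_rank_mod_prime:
  fixes S :: "'m \<Rightarrow> 'm \<Rightarrow> 'a::comm_ring_1"
  assumes P: "is_prime_ideal P" and sym: "\<And>i j. S i j = S j i"
    and minors: "\<And>r c. inj_on r {..<Suc n} \<Longrightarrow> inj_on c {..<Suc n} \<Longrightarrow>
      Determinant.det (Matrix.mat (Suc n) (Suc n) (\<lambda>(a, b). S (r a) (c b))) \<in> P"
  obtains k r d c where "k \<le> n" and "inj_on r {..<k}" and "d \<notin> P"
    and "\<And>i j. d\<^sup>2 * S i j - (\<Sum>a<k. \<Sum>b<k. c i a * S (r a) (r b) * c j b) \<in> P"
proof -
  have ideal: "is_ideal P" and one: "1 \<notin> P" and prime: "\<And>a b. a * b \<in> P \<Longrightarrow> a \<in> P \<or> b \<in> P"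
    using P by (auto simp: is_prime_ideal_def)
  note ideals = is_idealD[OF ideal]
  define minor where "minor k r c = Determinant.det (Matrix.mat k k (\<lambda>(a, b). S (r a) (c b)))" for k r c
  \<comment> \<open>For \<open>k = 0\<close> the minor is the empty determinant 1, so a maximal size
    exists even if all entries of \<open>S\<close> lie in \<open>P\<close>.\<close>
  define good where "good k \<longleftrightarrow> k \<le> n \<and> (\<exists>r. inj_on r {..<k} \<and> minor k r r \<notin> P)" for k
  define k where "k = (GREATEST k. good k)"
  have "good 0" using one by (simp add: good_def minor_def Determinant.det_dim_zero[of "Matrix.mat 0 0 _"])
  then have k: "good k" unfolding k_def by (rule GreatestI_nat[where b = n]) (simp add: good_def)
  have max: "k' \<le> k" if "good k'" for k'
    unfolding k_def using that by (rule Greatest_le_nat[where b = n]) (simp add: good_def)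
  from k obtain r where kn: "k \<le> n" and r: "inj_on r {..<k}" and dP: "minor k r r \<notin> P"
    unfolding good_def by blast
  \<comment> \<open>Size \<open>n + 1\<close> is covered by the assumption on minors, smaller sizes
    by maximality of \<open>k\<close>.\<close>
  have principal: "minor k' r' r' \<in> P" if "k < k'" "k' \<le> Suc n" "inj_on r' {..<k'}" for k' r'
  proof (cases "k' = Suc n")
    case True
    then show ?thesis using minors that(3) unfolding minor_def by blast
  next
    case False
    with that have "k' \<le> n" by simp
    with max[of k'] that show ?thesis unfolding good_def by force
  qed
  define A where "A = Matrix.mat k k (\<lambda>(a, b). S (r a) (r b))"
  define d where "d = Determinant.det A"
  have A: "A \<in> carrier_mat k k" by (simp add: A_def)
  note A' = adj_mat[OF A]
  have d: "d \<notin> P" using dP by (simp add: d_def A_def minor_def)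
  define h where "h a b = adj_mat A $$ (a, b)" for a b
  have "transpose_mat A = A" by (rule eq_matI) (auto simp: A_def sym)
  with adj_mat_transpose[OF A] have tr: "transpose_mat (adj_mat A) = adj_mat A" by simp
  have hsym: "h a b = h b a" if "a < k" "b < k" for a b
    unfolding h_def by (subst tr[symmetric]) (use that A' in simp)
  have hA: "(\<Sum>b<k. h a b * S (r b) (r c)) = (if a = c then d else 0)" if "a < k" "c < k" for a c
  proof -
    have "(adj_mat A * A) $$ (a, c) = (\<Sum>b<k. h a b * S (r b) (r c))"
    proof -
      have "(adj_mat A * A) $$ (a, c) = (\<Sum>b<k. h a b * A $$ (b, c))"
        using that A'(1) A by (simp add: scalar_prod_def h_def atLeast0LessThan)
      also have "\<dots> = (\<Sum>b<k. h a b * S (r b) (r c))"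
        by (intro sum.cong refl) (use that in \<open>simp add: A_def\<close>)
      finally show ?thesis .
    qed
    moreover have "(adj_mat A * A) $$ (a, c) = (if a = c then d else 0)"
      unfolding A'(3) using that by (simp add: d_def)
    ultimately show ?thesis by simp
  qed
  define q where "q i j = d * S i j - (\<Sum>a<k. \<Sum>b<k. S i (r a) * h a b * S (r b) j)" for i j
  have qsym: "q i j = q j i" for i j
  proof -
    have "(\<Sum>a<k. \<Sum>b<k. S i (r a) * h a b * S (r b) j) = (\<Sum>b<k. \<Sum>a<k. S i (r a) * h a b * S (r b) j)"
      by (rule sum.swap)
    also have "\<dots> = (\<Sum>b<k. \<Sum>a<k. S j (r b) * h b a * S (r a) i)"
      by (intro sum.cong refl) (auto simp: hsym sym mult_ac)
    finally show ?thesis unfolding q_def by (simp add: sym)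
  qed
  \<comment> \<open>By \<open>det_bordered_dvd\<close>, a multiple of the large minor is a power of
    \<open>d\<close> times a power of the determinant of the \<open>q\<close>-block. Since
    \<open>P\<close> is prime and \<open>d\<close> is outside, that determinant lies in
    \<open>P\<close>.\<close>
  have border: "Determinant.det (Matrix.mat l l (\<lambda>(a, b). q (u a) (v b))) \<in> P"
    if M: "minor (k + l) (\<lambda>a. if a < k then r a else u (a - k)) (\<lambda>a. if a < k then r a else v (a - k)) \<in> P" for l u v
  proof -
    let ?B = "Matrix.mat k l (\<lambda>(a, b). S (r a) (v b))"
    let ?C = "Matrix.mat l k (\<lambda>(a, b). S (u a) (r b))"
    let ?D = "Matrix.mat l l (\<lambda>(a, b). S (u a) (v b))"
    have eq: "Matrix.mat (k + l) (k + l) (\<lambda>(a, b). S (if a < k then r a else u (a - k)) (if b < k then r b else v (b - k)))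
      = four_block_mat A ?B ?C ?D"
      by (rule eq_matI) (auto simp: A_def)
    have Q: "d \<cdot>\<^sub>m ?D - ?C * (adj_mat A * ?B) = Matrix.mat l l (\<lambda>(a, b). q (u a) (v b))"
    proof (rule eq_matI)
      fix a b assume "a < dim_row (Matrix.mat l l (\<lambda>(a, b). q (u a) (v b)))" "b < dim_col (Matrix.mat l l (\<lambda>(a, b). q (u a) (v b)))"
      then have ab: "a < l" "b < l" by auto
      then have "(?C * (adj_mat A * ?B)) $$ (a, b) = (\<Sum>i<k. S (u a) (r i) * (\<Sum>j<k. h i j * S (r j) (v b)))"
        using A' by (simp add: scalar_prod_def h_def atLeast0LessThan)
      then show "(d \<cdot>\<^sub>m ?D - ?C * (adj_mat A * ?B)) $$ (a, b) = Matrix.mat l l (\<lambda>(a, b). q (u a) (v b)) $$ (a, b)"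
        using ab A' by (simp add: q_def sum_distrib_left mult.assoc)
    qed (use A' in auto)
    have "Determinant.det (four_block_mat A ?B ?C ?D) dvd d ^ k * Determinant.det (d \<cdot>\<^sub>m ?D - ?C * (adj_mat A * ?B)) ^ l"
      unfolding d_def by (rule det_bordered_dvd[OF A]) auto
    then have "d ^ k * Determinant.det (d \<cdot>\<^sub>m ?D - ?C * (adj_mat A * ?B)) ^ l \<in> P"
      using M unfolding minor_def eq dvd_def by (auto intro: ideals)
    with prime d is_prime_ideal_power[OF P] show ?thesis unfolding Q by blast
  qed
  have qP: "q i j \<in> P" for i j
  proof -
    \<comment> \<open>Here the bordered matrix repeats a row, a case outside the reach of injective
      enumerations; the adjugate identity \<open>hA\<close> gives exact vanishing instead.\<close>
    have zero: "q i j = 0" if i: "i \<in> r ` {..<k}" for i j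
    proof -
      from i obtain c where c: "c < k" "i = r c" by auto
      have "(\<Sum>a<k. \<Sum>b<k. S i (r a) * h a b * S (r b) j) = (\<Sum>b<k. (\<Sum>a<k. h b a * S (r a) (r c)) * S (r b) j)"
        unfolding c sum_distrib_right
        by (subst sum.swap) (intro sum.cong refl, simp add: hsym sym[of "r c"] mult_ac)
      also have "\<dots> = (\<Sum>b<k. if b = c then d * S (r b) j else 0)"
        by (intro sum.cong refl) (use c hA in auto)
      also have "\<dots> = d * S i j" using c by simp
      finally show ?thesis unfolding q_def by simp
    qed
    have inj1: "inj_on (\<lambda>a. if a < k then r a else (\<lambda>_. i) (a - k)) {..<k + 1}" if "i \<notin> r ` {..<k}" for i
      using r that by (auto simp: inj_on_def less_Suc_eq)
    have det1: "Determinant.det (Matrix.mat 1 1 (\<lambda>(a, b). q i j)) = q i j" for i j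
      by (subst det_single) auto
    consider "i \<in> r ` {..<k}" | "j \<in> r ` {..<k}" | "i \<notin> r ` {..<k}" "j \<notin> r ` {..<k}" by blast
    then show ?thesis
    proof cases
      case 1
      then show ?thesis using zero ideals by simp
    next
      case 2
      then show ?thesis using zero ideals qsym[of i j] by simp
    next
      case ij: 3
      have diag: "q i i \<in> P" if "i \<notin> r ` {..<k}" for i
        using border[OF principal[OF _ _ inj1[OF that]]] kn by (simp add: det1[unfolded One_nat_def])
      \<comment> \<open>For \<open>k = n\<close> the border by \<open>i\<close> and \<open>j\<close>
        is already a minor of size \<open>n + 1\<close>, principal or not. For \<open>k < n\<close>
        there is room for both borders, as \<open>k + 2\<close> is at most
        \<open>n + 1\<close>.\<close>
      show ?thesis
      proof (cases "i = j \<or> k = n")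
        case True
        then show ?thesis
        proof
          assume "i = j" then show ?thesis using diag ij by simp
        next
          assume "k = n"
          then have "minor (k + 1) r' c' \<in> P" if "inj_on r' {..<k + 1}" "inj_on c' {..<k + 1}" for r' c'
            using minors[of r' c'] that by (simp add: minor_def)
          from border[OF this[OF inj1[OF ij(1)] inj1[OF ij(2)]]] show ?thesis by (simp add: det1[unfolded One_nat_def])
        qed
      next
        case False
        let ?u = "\<lambda>a :: nat. if a = 0 then i else j"
        have "inj_on (\<lambda>a. if a < k then r a else ?u (a - k)) {..<k + 2}"
          using r ij False by (auto simp: inj_on_def less_Suc_eq numeral_2_eq_2)
        then have "Determinant.det (Matrix.mat 2 2 (\<lambda>(a, b). q (?u a) (?u b))) \<in> P"
          using kn False by (intro border principal) auto
        also have "Determinant.det (Matrix.mat 2 2 (\<lambda>(a, b). q (?u a) (?u b))) = q i i * q j j - q i j * q i j"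
          by (subst det_mat_2) (auto simp: qsym)
        finally have "q i i * q j j - (q i i * q j j - q i j * q i j) \<in> P"
          using ideals(6)[OF ideals(4)[OF diag[OF ij(1)]]] by blast
        then show ?thesis using prime[of "q i j" "q i j"] by simp
      qed
    qed
  qed
  \<comment> \<open>Row \<open>i\<close> of \<open>S\<close>, restricted to the columns
    \<open>r\<close>, times the adjugate. The adjugate satisfies \<open>h A h = d h\<close>, which
    is why \<open>d\<close> enters squared.\<close>
  define c where "c i a = (\<Sum>b<k. S i (r b) * h b a)" for i a
  have "d\<^sup>2 * S i j - (\<Sum>a<k. \<Sum>b<k. c i a * S (r a) (r b) * c j b) \<in> P" for i j
  proof -
    have "(\<Sum>a<k. \<Sum>b<k. c i a * S (r a) (r b) * c j b) = (\<Sum>b<k. (\<Sum>a<k. c i a * S (r a) (r b)) * c j b)"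
      by (subst sum.swap) (simp add: sum_distrib_right)
    also have "\<dots> = (\<Sum>b<k. d * S i (r b) * c j b)"
    proof (intro sum.cong refl arg_cong2[of _ _ _ _ "(*)"])
      fix b assume b: "b \<in> {..<k}"
      have "(\<Sum>a<k. c i a * S (r a) (r b)) = (\<Sum>e<k. S i (r e) * (\<Sum>a<k. h e a * S (r a) (r b)))"
        unfolding c_def sum_distrib_right sum_distrib_left by (subst sum.swap) (simp add: mult.assoc)
      also have "\<dots> = (\<Sum>e<k. if e = b then S i (r e) * d else 0)"
        by (intro sum.cong refl) (use b hA in auto)
      finally show "(\<Sum>a<k. c i a * S (r a) (r b)) = d * S i (r b)" using b by (simp add: mult.commute)
    qed
    also have "\<dots> = d * (\<Sum>a<k. \<Sum>b<k. S i (r a) * h a b * S (r b) j)"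
      unfolding c_def sum_distrib_left by (intro sum.cong refl) (auto simp: hsym sym mult_ac)
    finally have "d\<^sup>2 * S i j - (\<Sum>a<k. \<Sum>b<k. c i a * S (r a) (r b) * c j b) = d * q i j"
      by (simp add: q_def algebra_simps power2_eq_square)
    then show ?thesis using qP by (auto intro: ideals)
  qed
  with kn r d that show thesis by blast
qed

text \<open>Cholesky factorization, by induction on the size: the last row is split off and the
  hypothesis is applied to the Schur complement \<open>B'\<close>.\<close>

lemma gram_of_pos_def:
  fixes B :: "nat \<Rightarrow> nat \<Rightarrow> real"
  assumes "\<And>a b. a < k \<Longrightarrow> b < k \<Longrightarrow> B a b = B b a"
    and "\<And>x. (\<exists>a<k. x a \<noteq> 0) \<Longrightarrow> (\<Sum>a<k. \<Sum>b<k. x a * x b * B a b) > 0"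
  shows "\<exists>v. \<forall>a<k. \<forall>b<k. B a b = (\<Sum>l<k. v a l * v b l)"
  using assms
proof (induction k arbitrary: B)
  case (Suc k)
  define p where "p = B k k"
  have "(\<Sum>a<Suc k. \<Sum>b<Suc k. (if a = k then 1 else 0) * (if b = k then 1 else 0) * B a b) > 0"
    by (rule Suc.prems(2)) auto
  also have "(\<Sum>a<Suc k. \<Sum>b<Suc k. (if a = k then 1 else 0) * (if b = k then 1 else 0) * B a b) = p"
    by (simp add: p_def)
  finally have p: "p > 0" .
  define B' where "B' a b = B a b - B a k * B b k / p" for a b
  have "\<exists>v. \<forall>a<k. \<forall>b<k. B' a b = (\<Sum>l<k. v a l * v b l)"
  proof (rule Suc.IH)
    show "B' a b = B' b a" if "a < k" "b < k" for a b
      using that Suc.prems(1)[of a b] by (simp add: B'_def)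
  next
    fix x :: "nat \<Rightarrow> real" assume x: "\<exists>a<k. x a \<noteq> 0"
    define s where "s = (\<Sum>a<k. x a * B a k)"
    \<comment> \<open>The last coordinate minimizes the form of \<open>B\<close> for given
      \<open>x\<close>; the minimum is the value at \<open>x\<close> of the form of
      \<open>B'\<close>.\<close>
    define x' where "x' = x(k := - s / p)"
    have "0 < (\<Sum>a<Suc k. \<Sum>b<Suc k. x' a * x' b * B a b)"
      by (rule Suc.prems(2)) (use x in \<open>auto simp: x'_def less_Suc_eq\<close>)
    also have "\<dots> = (\<Sum>a<k. \<Sum>b<k. x a * x b * B a b) + (\<Sum>a<k. x a * (- s / p) * B a k)
        + (\<Sum>b<k. (- s / p) * x b * B k b) + (- s / p) * (- s / p) * p"
      by (simp add: x'_def sum.distrib p_def sum_subtractf sum_negf)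
    also have "(\<Sum>b<k. (- s / p) * x b * B k b) = (\<Sum>b<k. x b * (- s / p) * B b k)"
      by (intro sum.cong refl) (use Suc.prems(1) in auto)
    also have "(\<Sum>a<k. x a * (- s / p) * B a k) = (- s / p) * s"
      unfolding s_def sum_distrib_left by (intro sum.cong refl) auto
    also have "(\<Sum>a<k. \<Sum>b<k. x a * x b * B a b) + (- s / p) * s + (- s / p) * s + (- s / p) * (- s / p) * p
      = (\<Sum>a<k. \<Sum>b<k. x a * x b * B a b) - s * s / p"
      using p by (simp add: field_simps)
    also have "s * s / p = (\<Sum>a<k. \<Sum>b<k. x a * x b * (B a k * B b k / p))"
      unfolding s_def sum_product by (simp add: sum_divide_distrib mult_ac)
    also have "(\<Sum>a<k. \<Sum>b<k. x a * x b * B a b) - \<dots> = (\<Sum>a<k. \<Sum>b<k. x a * x b * B' a b)"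
      by (simp add: B'_def right_diff_distrib sum_subtractf)
    finally show "0 < (\<Sum>a<k. \<Sum>b<k. x a * x b * B' a b)" .
  qed
  then obtain v where v: "\<And>a b. a < k \<Longrightarrow> b < k \<Longrightarrow> B' a b = (\<Sum>l<k. v a l * v b l)" by blast
  \<comment> \<open>Column \<open>k\<close> carries the rank-one part removed in \<open>B'\<close>,
    and row \<open>k\<close> has no other nonzero entry.\<close>
  define w where "w a l = (if l = k then B a k / sqrt p else if a = k then 0 else v a l)" for a l
  have "B a b = (\<Sum>l<Suc k. w a l * w b l)" if ab: "a < Suc k" "b < Suc k" for a b
  proof -
    have "(\<Sum>l<Suc k. w a l * w b l) = (\<Sum>l<k. w a l * w b l) + B a k * B b k / p"
      using p by (simp add: w_def)
    also have "(\<Sum>l<k. w a l * w b l) = (if a = k \<or> b = k then 0 else B' a b)"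
      using ab by (auto simp: w_def v)
    finally show ?thesis
      using p ab Suc.prems(1)[of a b] by (auto simp: B'_def p_def)
  qed
  then show ?case by (intro exI[of _ w]) blast
qed simp

text \<open>Each off-diagonal term costs at most the mean of two squares, and against the diagonal
  allowance \<open>real k\<close> the sum of all squares is left over. The explicit bounds on single
  entries leave room for a product of infinite sets, as the grid argument requires.\<close>

lemma diagonally_dominant_pos_def:
  fixes B :: "nat \<Rightarrow> nat \<Rightarrow> real"
  assumes diag: "\<And>a. a < k \<Longrightarrow> B a a \<ge> real k" and off: "\<And>a b. a < k \<Longrightarrow> b < k \<Longrightarrow> a \<noteq> b \<Longrightarrow> \<bar>B a b\<bar> \<le> 1"
    and x: "\<exists>a<k. x a \<noteq> 0"
  shows "(\<Sum>a<k. \<Sum>b<k. x a * x b * B a b) > 0"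
proof -
  have lower: "x a * x b * B a b \<ge> - ((x a)\<^sup>2 + (x b)\<^sup>2) / 2 + (if a = b then (real k + 1) * (x a)\<^sup>2 else 0)"
    if "a < k" "b < k" for a b
  proof (cases "a = b")
    case True
    have "real k * (x a)\<^sup>2 \<le> B a a * (x a)\<^sup>2" using diag that by (intro mult_right_mono) auto
    with True show ?thesis by (simp add: power2_eq_square algebra_simps)
  next
    case False
    have "\<bar>x a * x b * B a b\<bar> \<le> \<bar>x a\<bar> * \<bar>x b\<bar>"
      using off[OF that False] mult_left_mono[of "\<bar>B a b\<bar>" 1 "\<bar>x a\<bar> * \<bar>x b\<bar>"] by (simp add: abs_mult)
    moreover have "2 * (\<bar>x a\<bar> * \<bar>x b\<bar>) \<le> (x a)\<^sup>2 + (x b)\<^sup>2"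
      using sum_squares_bound[of "\<bar>x a\<bar>" "\<bar>x b\<bar>"] by simp
    ultimately show ?thesis using False by simp
  qed
  from x obtain a where "a < k" "x a \<noteq> 0" by blast
  then have "0 < (\<Sum>a<k. (x a)\<^sup>2)" by (intro sum_pos2[of _ a]) auto
  also have "\<dots> = (\<Sum>a<k. \<Sum>b<k. - ((x a)\<^sup>2 + (x b)\<^sup>2) / 2 + (if a = b then (real k + 1) * (x a)\<^sup>2 else 0))"
    by (simp add: sum.distrib sum_negf sum_subtractf sum_divide_distrib[symmetric] sum_distrib_left[symmetric] add_divide_distrib diff_divide_distrib algebra_simps)
  also have "\<dots> \<le> (\<Sum>a<k. \<Sum>b<k. x a * x b * B a b)"
    by (intro sum_mono lower) auto
  finally show ?thesis .
qed

section \<open>Polynomials vanishing on Gram matrices\<close>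

lemma uprod_lift:
  assumes "\<And>i j. h i j = h j i"
  obtains u where "\<And>i j. u (Upair i j) = h i j"
proof -
  have "\<exists>y. \<forall>i j. e = Upair i j \<longrightarrow> y = h i j" for e
    by (cases e) (use assms in auto)
  then show thesis using that by metis
qed

text \<open>
  The grid \<open>Z\<close> below consists of diagonally dominant, hence positive definite, matrices, so that the principal
  submatrix \<open>B\<close> is a Gram matrix over the reals.
\<close>

lemma vanishing_on_gram_mem_prime:
  fixes f :: "'m::finite uprod mpoly"
  assumes P: "is_prime_ideal P" and minors: "minors (Suc n) \<subseteq> P"
    and f: "\<And>\<sigma> Y. (\<And>i j. \<sigma> (Upair i j) = (\<Sum>l<n. Y i l * Y j l)) \<Longrightarrow> mpoly_eval \<sigma> f = 0"
  shows "f \<in> P"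
proof -
  have ideal: "is_ideal P" using P by (simp add: is_prime_ideal_def)
  let ?S = "unknown :: 'm \<Rightarrow> 'm \<Rightarrow> 'm uprod mpoly"
  have Ssym: "?S i j = ?S j i" for i j
  proof -
    have "Upair i j = Upair j i" by simp
    then show ?thesis unfolding unknown_def by metis
  qed
  have "Determinant.det (Matrix.mat (Suc n) (Suc n) (\<lambda>(a, b). ?S (r a) (c b))) \<in> P"
    if "inj_on r {..<Suc n}" "inj_on c {..<Suc n}" for r c
    using that minors unfolding minors_def by blast
  from low_rank_mod_prime[where S = ?S and n = n, OF P Ssym this]
  obtain k r d c where k: "k \<le> n" and r: "inj_on r {..<k}" and d: "d \<notin> P"
    and dc: "\<And>i j. d\<^sup>2 * ?S i j - (\<Sum>a<k. \<Sum>b<k. c i a * ?S (r a) (r b) * c j b) \<in> P" by blast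
  define h where "h i j = (\<Sum>a<k. \<Sum>b<k. c i a * ?S (r a) (r b) * c j b)" for i j
  have hsym: "h i j = h j i" for i j
    unfolding h_def by (subst sum.swap) (intro sum.cong refl, simp add: Ssym mult_ac)
  from uprod_lift[of h, OF hsym] obtain U where U: "\<And>i j. U (Upair i j) = h i j" by blast
  have "d\<^sup>2 * var e - U e \<in> P" for e
    using dc by (cases e) (simp add: U h_def unknown_def)
  from mpoly_homogeneous_substitution[OF ideal this, of f] obtain N where
    mem: "(d\<^sup>2) ^ N * f - (\<Sum>t\<in>Poly_Mapping.keys f. Poly_Mapping.single 0 (Poly_Mapping.lookup f t) *
     (d\<^sup>2) ^ (N - (\<Sum>v\<in>Poly_Mapping.keys t. Poly_Mapping.lookup t v)) *
     (\<Prod>v\<in>Poly_Mapping.keys t. U v ^ Poly_Mapping.lookup t v)) \<in> P" (is "_ - ?g \<in> P") and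
    N: "\<And>t. t \<in> Poly_Mapping.keys f \<Longrightarrow> (\<Sum>v\<in>Poly_Mapping.keys t. Poly_Mapping.lookup t v) \<le> N" by blast
  define Z :: "'m uprod \<Rightarrow> real set" where "Z e = (if proper_uprod e then {0..1} else {real n..})" for e
  \<comment> \<open>Where \<open>d\<close> evaluates to a nonzero number, \<open>?g\<close>
    evaluates to a power of it times the value of \<open>f\<close> at a Gram matrix. The factor
    \<open>d\<close> covers the remaining grid points and is cancelled afterwards because
    \<open>P\<close> is prime and does not contain \<open>d\<close>.\<close>
  have "d * ?g = 0"
  proof (rule mpoly_eq_0I[where Z = Z])
    show "infinite (Z e)" for e
      unfolding Z_def using infinite_Ici[of "real n"] infinite_Icc[of "0 :: real" 1] by auto
    fix \<sigma> assume "\<And>e. \<sigma> e \<in> Z e"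
    then have \<sigma>: "\<And>i. \<sigma> (Upair i i) \<ge> real n" "\<And>i j. i \<noteq> j \<Longrightarrow> 0 \<le> \<sigma> (Upair i j) \<and> \<sigma> (Upair i j) \<le> 1"
      unfolding Z_def by (metis (full_types) atLeast_iff atLeastAtMost_iff proper_uprod_simps)+
    let ?e = "mpoly_eval \<sigma>"
    show "?e (d * ?g) = 0"
    proof (cases "?e d = 0")
      case False
      define \<delta> where "\<delta> = ?e d"
      define B where "B a b = \<sigma> (Upair (r a) (r b))" for a b
      have Bsym: "B a b = B b a" for a b
      proof -
        have "Upair (r a) (r b) = Upair (r b) (r a)" by simp
        then show ?thesis unfolding B_def by metis
      qed
      have "\<exists>v. \<forall>a<k. \<forall>b<k. B a b = (\<Sum>l<k. v a l * v b l)"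
      proof (rule gram_of_pos_def[OF Bsym], rule diagonally_dominant_pos_def)
        show "B a a \<ge> real k" if "a < k" for a
          using \<sigma>(1)[of "r a"] k unfolding B_def by linarith
        show "\<bar>B a b\<bar> \<le> 1" if "a < k" "b < k" "a \<noteq> b" for a b
          using \<sigma>(2)[of "r a" "r b"] inj_on_eq_iff[OF r, of a b] that by (auto simp: B_def)
      qed auto
      then obtain v where v: "\<And>a b. a < k \<Longrightarrow> b < k \<Longrightarrow> B a b = (\<Sum>l<k. v a l * v b l)" by blast
      \<comment> \<open>The evaluated coefficients over \<open>\<delta>\<close> times the factor
        \<open>v\<close> of \<open>B\<close>, padded with zero columns from \<open>k\<close> up to
        \<open>n\<close>.\<close>
      define Y where "Y i l = (if l < k then \<Sum>a<k. ?e (c i a) / \<delta> * v a l else 0)" for i l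
      have \<tau>: "?e (U (Upair i j)) / \<delta>\<^sup>2 = (\<Sum>l<n. Y i l * Y j l)" for i j
      proof -
        have "?e (U (Upair i j)) / \<delta>\<^sup>2 = (\<Sum>a<k. \<Sum>b<k. ?e (c i a) / \<delta> * B a b * (?e (c j b) / \<delta>))"
          by (simp add: U h_def mpoly_eval.hom_sum mpoly_eval.hom_mult unknown_def mpoly_eval_var[unfolded One_nat_def] B_def
              sum_divide_distrib power2_eq_square)
        also have "\<dots> = (\<Sum>a<k. \<Sum>b<k. \<Sum>l<k. (?e (c i a) / \<delta> * v a l) * (?e (c j b) / \<delta> * v b l))"
          by (intro sum.cong refl) (auto simp: v sum_distrib_left sum_distrib_right mult_ac intro!: sum.cong)
        also have "\<dots> = (\<Sum>a<k. \<Sum>l<k. \<Sum>b<k. (?e (c i a) / \<delta> * v a l) * (?e (c j b) / \<delta> * v b l))"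
          by (intro sum.cong refl sum.swap)
        also have "\<dots> = (\<Sum>l<k. Y i l * Y j l)"
          by (subst sum.swap) (auto simp: Y_def sum_product intro!: sum.cong)
        also have "\<dots> = (\<Sum>l<n. Y i l * Y j l)"
          using k by (intro sum.mono_neutral_left) (auto simp: Y_def)
        finally show ?thesis .
      qed
      have "?e ?g = (\<delta>\<^sup>2) ^ N * mpoly_eval (\<lambda>e. ?e (U e) / \<delta>\<^sup>2) f"
      proof -
        have "?e ?g = (\<Sum>t\<in>Poly_Mapping.keys f. Poly_Mapping.lookup f t *
          (\<delta>\<^sup>2) ^ (N - (\<Sum>v\<in>Poly_Mapping.keys t. Poly_Mapping.lookup t v)) *
          (\<Prod>v\<in>Poly_Mapping.keys t. ?e (U v) ^ Poly_Mapping.lookup t v))"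
          by (simp add: mpoly_eval.hom_sum mpoly_eval.hom_mult mpoly_eval.hom_prod mpoly_eval.hom_power
              mpoly_eval_single \<delta>_def)
        also have "\<dots> = (\<Sum>t\<in>Poly_Mapping.keys f. (\<delta>\<^sup>2) ^ N * (Poly_Mapping.lookup f t * monom_eval (\<lambda>e. ?e (U e) / \<delta>\<^sup>2) t))"
        proof (intro sum.cong refl)
          fix t assume t: "t \<in> Poly_Mapping.keys f"
          let ?deg = "\<Sum>v\<in>Poly_Mapping.keys t. Poly_Mapping.lookup t v"
          have "(\<delta>\<^sup>2) ^ N = (\<delta>\<^sup>2) ^ (N - ?deg) * (\<delta>\<^sup>2) ^ ?deg" using N[OF t] by (simp flip: power_add)
          also have "(\<delta>\<^sup>2) ^ ?deg = (\<Prod>v\<in>Poly_Mapping.keys t. (\<delta>\<^sup>2) ^ Poly_Mapping.lookup t v)"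
            by (rule power_sum)
          finally have "(\<delta>\<^sup>2) ^ N * monom_eval (\<lambda>e. ?e (U e) / \<delta>\<^sup>2) t = (\<delta>\<^sup>2) ^ (N - ?deg) *
            (\<Prod>v\<in>Poly_Mapping.keys t. (\<delta>\<^sup>2) ^ Poly_Mapping.lookup t v * (?e (U v) / \<delta>\<^sup>2) ^ Poly_Mapping.lookup t v)"
            by (simp add: monom_eval_def prod.distrib mult_ac)
          also have "(\<Prod>v\<in>Poly_Mapping.keys t. (\<delta>\<^sup>2) ^ Poly_Mapping.lookup t v * (?e (U v) / \<delta>\<^sup>2) ^ Poly_Mapping.lookup t v)
            = (\<Prod>v\<in>Poly_Mapping.keys t. ?e (U v) ^ Poly_Mapping.lookup t v)"
            using False by (intro prod.cong refl) (simp add: \<delta>_def flip: power_mult_distrib)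
          finally show "Poly_Mapping.lookup f t * (\<delta>\<^sup>2) ^ (N - ?deg) * (\<Prod>v\<in>Poly_Mapping.keys t. ?e (U v) ^ Poly_Mapping.lookup t v)
            = (\<delta>\<^sup>2) ^ N * (Poly_Mapping.lookup f t * monom_eval (\<lambda>e. ?e (U e) / \<delta>\<^sup>2) t)"
            by (simp add: mult_ac)
        qed
        finally show ?thesis by (simp add: mpoly_eval_def sum_distrib_left)
      qed
      also have "mpoly_eval (\<lambda>e. ?e (U e) / \<delta>\<^sup>2) f = 0" by (rule f[where Y = Y]) (rule \<tau>)
      finally show ?thesis by (simp add: mpoly_eval.hom_mult)
    qed (simp add: mpoly_eval.hom_mult)
  qed simp
  then have "d * ?g \<in> P" using is_idealD[OF ideal] by simp
  then have "?g \<in> P" using d P by (auto simp: is_prime_ideal_def)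
  with is_idealD(2)[OF ideal mem this] have "(d\<^sup>2) ^ N * f \<in> P" by simp
  then have "d ^ (2 * N) \<in> P \<or> f \<in> P" using P unfolding is_prime_ideal_def by (simp add: power_mult)
  with d is_prime_ideal_power[OF P] show ?thesis by blast
qed

text \<open>Powers of \<open>f\<close> stay in the edge subring, so for \<open>f\<close> nonzero
  none of them lies in the ideal of minors. A prime above the minors that avoids \<open>f\<close>
  then contradicts \<open>vanishing_on_gram_mem_prime\<close>.\<close>

lemma vanishing_on_gram_eq_0:
  fixes f :: "'m::finite uprod mpoly"
  assumes elim: "elimination_ideal E n = {0}" and fE: "f \<in> edge_subring E"
    and f: "\<And>\<sigma> Y. (\<And>i j. \<sigma> (Upair i j) = (\<Sum>l<n. Y i l * Y j l)) \<Longrightarrow> mpoly_eval \<sigma> f = 0"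
  shows "f = 0"
proof (rule ccontr)
  assume "f \<noteq> 0"
  then obtain x where x: "mpoly_eval x f \<noteq> 0"
    using mpoly_eq_0I[of "\<lambda>_. UNIV" f] infinite_UNIV_char_0[where 'a = real] by auto
  have "f ^ k \<noteq> 0" for k
  proof
    assume "f ^ k = 0"
    then have "mpoly_eval x f ^ k = 0" by (metis mpoly_eval.hom_power mpoly_eval.hom_zero)
    with x show False by simp
  qed
  then have "f ^ k \<notin> ideal_generated (minors (n + 1))" for k
    using elim edge_subring_power[OF fE, of k] unfolding elimination_ideal_def by blast
  from prime_ideal_avoiding_powers[OF is_ideal_generated this]
  obtain P where P: "is_prime_ideal P" "ideal_generated (minors (n + 1)) \<subseteq> P" "f \<notin> P" by blast
  have "minors (Suc n) \<subseteq> P" using P(2) ideal_generated_superset[of "minors (n + 1)"] by auto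
  from P(1) this have "f \<in> P"
  proof (rule vanishing_on_gram_mem_prime)
    fix \<sigma> :: "'m uprod \<Rightarrow> real" and Y assume "\<And>i j. \<sigma> (Upair i j) = (\<Sum>l<n. Y i l * Y j l)"
    then show "mpoly_eval \<sigma> f = 0" by (rule f)
  qed
  with P(3) show False by simp
qed

definition pos_semidef :: "real^'m^'m \<Rightarrow> bool" where
  "pos_semidef A \<longleftrightarrow> Finite_Cartesian_Product.transpose A = A \<and> (\<forall>x. x \<bullet> (A *v x) \<ge> 0)"

subsection \<open>Existence of the maximum likelihood estimator\<close>

lemma transpose_eq_self_iff:
  "Finite_Cartesian_Product.transpose A = A \<longleftrightarrow> (\<forall>i j. A $ j $ i = A $ i $ j)"
  by (simp add: Finite_Cartesian_Product.transpose_def Finite_Cartesian_Product.vec_eq_iff)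

lemma det_scaleR:
  fixes A :: "real^'m^'m"
  shows "Determinants.det (c *\<^sub>R A) = c ^ CARD('m) * Determinants.det A"
  unfolding Determinants.det_def by (simp add: prod.distrib sum_distrib_left mult_ac)

lemma continuous_on_det [continuous_intros]:
  fixes f :: "'a::topological_space \<Rightarrow> real^'m^'m"
  assumes "continuous_on S f"
  shows "continuous_on S (\<lambda>x. Determinants.det (f x))"
  unfolding Determinants.det_def by (intro continuous_intros assms)

lemma continuous_on_quadratic_form [continuous_intros]:
  fixes f :: "'a::topological_space \<Rightarrow> real^'m^'m"
  assumes "continuous_on S f"
  shows "continuous_on S (\<lambda>K. x \<bullet> (f K *v x))"
  unfolding inner_vec_def matrix_vector_mult_def by (simp, intro continuous_intros assms)

lemma continuous_on_trace_mult [continuous_intros]: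
  fixes f :: "'a::topological_space \<Rightarrow> real^'m^'m"
  assumes "continuous_on S f"
  shows "continuous_on S (\<lambda>K. Determinants.trace (A ** f K))"
  unfolding Determinants.trace_def matrix_matrix_mult_def by (simp, intro continuous_intros assms)

lemma symmetric_inner:
  fixes A :: "real^'m^'m"
  assumes "Finite_Cartesian_Product.transpose A = A"
  shows "x \<bullet> (A *v y) = y \<bullet> (A *v x)"
  by (metis assms dot_lmul_matrix inner_commute transpose_matrix_vector)

text \<open>If \<open>A *v x\<close> were nonzero, a step from \<open>x\<close> against
  \<open>A *v x\<close> would make the quadratic form negative.\<close>

lemma pos_semidef_kernel:
  fixes A :: "real^'m^'m"
  assumes A: "pos_semidef A" and x: "x \<bullet> (A *v x) = 0"
  shows "A *v x = 0"
proof (rule ccontr)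
  define y where "y = A *v x"
  define a where "a = y \<bullet> y"
  define c where "c = y \<bullet> (A *v y)"
  assume "A *v x \<noteq> 0"
  then have a: "a > 0" by (simp add: a_def y_def)
  have c: "c \<ge> 0" using A by (simp add: c_def pos_semidef_def)
  \<comment> \<open>The minimizing step would be \<open>- a / c\<close>; the denominator
    \<open>c + 1\<close> also works for \<open>c = 0\<close>.\<close>
  define t where "t = - a / (c + 1)"
  have sym: "x \<bullet> (A *v y) = a"
    using A symmetric_inner[of A x y] by (simp add: a_def y_def pos_semidef_def)
  have "0 \<le> (x + t *\<^sub>R y) \<bullet> (A *v (x + t *\<^sub>R y))" using A by (simp add: pos_semidef_def)
  also have "\<dots> = x \<bullet> (A *v x) + t * (x \<bullet> (A *v y)) + t * (y \<bullet> (A *v x)) + t * t * (y \<bullet> (A *v y))"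
    by (simp add: matrix_vector_right_distrib matrix_vector_mult_scaleR inner_add_left inner_add_right algebra_simps)
  also have "\<dots> = 2 * t * a + t * t * c"
    using x sym by (simp add: a_def c_def y_def[symmetric])
  also have "\<dots> = - (a\<^sup>2 * (c + 2) / (c + 1)\<^sup>2)"
  proof -
    have "t * (c + 1) = - a" using c by (simp add: t_def)
    then have t: "t * c = - a - t" by (simp add: algebra_simps)
    have "2 * t * a + t * t * c = t * (2 * a + t * c)" by (simp add: algebra_simps)
    also have "\<dots> = t * (a - t)" unfolding t by simp
    also have "\<dots> = - (a * (a * (c + 2)) / ((c + 1) * (c + 1)))"
    proof -
      have "a - t = a * (c + 2) / (c + 1)" using c by (simp add: t_def divide_simps) (simp add: algebra_simps)
      then show ?thesis by (simp add: t_def)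
    qed
    finally show ?thesis by (simp add: power2_eq_square mult.assoc)
  qed
  also have "\<dots> < 0" using a c by simp
  finally show False by simp
qed

lemma pos_def_imp_semidef: "pos_def A \<Longrightarrow> pos_semidef A"
  unfolding pos_def_def pos_semidef_def by (metis inner_zero_left less_eq_real_def order_refl)

lemma pos_def_det_nonzero:
  fixes A :: "real^'m^'m"
  assumes "pos_def A" shows "Determinants.det A \<noteq> 0"
proof -
  have "x = 0" if "A *v x = 0" for x
    using assms that unfolding pos_def_def by (metis inner_zero_right less_irrefl)
  then show ?thesis
    using invertible_det_nz[of A] invertible_left_inverse[of A] matrix_left_invertible_ker[of A] by blast
qed

lemma pos_def_convex:
  fixes A B :: "real^'m^'m"
  assumes "pos_def A" "pos_def B" "0 \<le> t" "t \<le> 1"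
  shows "pos_def ((1 - t) *\<^sub>R A + t *\<^sub>R B)"
  unfolding pos_def_def
proof (intro conjI allI impI)
  show "Finite_Cartesian_Product.transpose ((1 - t) *\<^sub>R A + t *\<^sub>R B) = (1 - t) *\<^sub>R A + t *\<^sub>R B"
    using assms(1,2) unfolding pos_def_def transpose_eq_self_iff by simp
  fix x :: "real^'m" assume "x \<noteq> 0"
  then have "x \<bullet> (A *v x) > 0" "x \<bullet> (B *v x) > 0" using assms by (auto simp: pos_def_def)
  then have "(1 - t) * (x \<bullet> (A *v x)) + t * (x \<bullet> (B *v x)) > 0"
    using assms(3,4) by (cases "t = 0") (auto intro: add_nonneg_pos)
  then show "x \<bullet> (((1 - t) *\<^sub>R A + t *\<^sub>R B) *v x) > 0"
    by (simp add: matrix_vector_mult_add_rdistrib inner_add_right flip: scaleR_matrix_vector_assoc)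
qed

lemma pos_def_id: "pos_def (Finite_Cartesian_Product.mat 1)"
  by (simp add: pos_def_def)

text \<open>On the segment from the identity to \<open>A\<close> all matrices are positive definite,
  so the determinant never vanishes and keeps the sign it has at the identity.\<close>

lemma pos_def_det_pos:
  fixes A :: "real^'m^'m"
  assumes A: "pos_def A" shows "Determinants.det A > 0"
proof (rule ccontr)
  assume neg: "\<not> ?thesis"
  let ?f = "\<lambda>t. Determinants.det ((1 - t) *\<^sub>R Finite_Cartesian_Product.mat 1 + t *\<^sub>R A)"
  have "\<exists>t. 0 \<le> t \<and> t \<le> 1 \<and> ?f t = 0"
    by (rule IVT2') (use neg in \<open>auto intro!: continuous_intros\<close>)
  then show False using pos_def_det_nonzero[OF pos_def_convex[OF pos_def_id A]] by blast
qed

lemma pos_semidef_det_nonzero_imp_pos_def: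
  fixes A :: "real^'m^'m"
  assumes A: "pos_semidef A" and det: "Determinants.det A \<noteq> 0"
  shows "pos_def A"
proof -
  have ker: "x = 0" if "A *v x = 0" for x
    using det invertible_det_nz[of A] invertible_left_inverse[of A] matrix_left_invertible_ker[of A] that by blast
  show ?thesis unfolding pos_def_def
  proof (intro conjI allI impI)
    show "Finite_Cartesian_Product.transpose A = A" using A by (simp add: pos_semidef_def)
    fix x :: "real^'m" assume "x \<noteq> 0"
    with ker pos_semidef_kernel[OF A, of x] have "x \<bullet> (A *v x) \<noteq> 0" by blast
    then show "x \<bullet> (A *v x) > 0" using A unfolding pos_semidef_def by (metis less_eq_real_def)
  qed
qed

lemma trace_sample_covariance_mult:
  "Determinants.trace (sample_covariance n x ** K) = (1 / real n) * (\<Sum>k<n. x k \<bullet> (Finite_Cartesian_Product.transpose K *v x k))"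
proof -
  have "Determinants.trace (sample_covariance n x ** K)
    = (\<Sum>i\<in>UNIV. \<Sum>j\<in>UNIV. \<Sum>k<n. 1 / real n * (x k $ i * (K $ j $ i * x k $ j)))"
    by (simp add: Determinants.trace_def matrix_matrix_mult_def sample_covariance_def sum_component sum_distrib_left sum_distrib_right mult_ac)
  also have "\<dots> = (\<Sum>i\<in>UNIV. \<Sum>k<n. \<Sum>j\<in>UNIV. 1 / real n * (x k $ i * (K $ j $ i * x k $ j)))"
    by (intro sum.cong refl sum.swap)
  also have "\<dots> = (\<Sum>k<n. \<Sum>i\<in>UNIV. \<Sum>j\<in>UNIV. 1 / real n * (x k $ i * (K $ j $ i * x k $ j)))"
    by (rule sum.swap)
  finally show ?thesis
    by (simp add: inner_vec_def matrix_vector_mult_def Finite_Cartesian_Product.transpose_def sum_distrib_left)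
qed

text \<open>A closed cone around the concentration matrices; its intersection with the unit sphere
  is compact.\<close>

definition sparse_semidef :: "('m \<times> 'm) set \<Rightarrow> (real^'m^'m) set" where
  "sparse_semidef E = {K. pos_semidef K \<and> (\<forall>i j. (i, j) \<notin> E \<longrightarrow> K $ i $ j = 0)}"

lemma closed_sparse_semidef: "closed (sparse_semidef E)"
proof -
  have "sparse_semidef E = {K. \<forall>i j. K $ j $ i = K $ i $ j} \<inter> (\<Inter>x. {K. 0 \<le> x \<bullet> (K *v x)}) \<inter>
      {K. \<forall>i j. (i, j) \<notin> E \<longrightarrow> K $ i $ j = 0}"
    unfolding sparse_semidef_def pos_semidef_def transpose_eq_self_iff by blast
  also have "closed \<dots>"
    by (intro closed_Int closed_INT closed_Collect_all closed_Collect_imp closed_Collect_le closed_Collect_eq ballI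
        continuous_intros) (auto intro!: continuous_intros)
  finally show ?thesis .
qed

text \<open>On the unit slice of the cone the trace has a positive minimum \<open>c\<close> and the
  determinant a maximum \<open>D\<close>. Scaling bounds the likelihood at norm
  \<open>\<rho>\<close> by \<open>?m * ln \<rho> + ln D - c * \<rho>\<close>, so superlevel sets are
  bounded.\<close>

lemma mle_exists_if_no_sparse_kernel:
  fixes x :: "nat \<Rightarrow> real^'m"
  assumes E: "refl E" and n: "n \<ge> 1"
    and ker: "\<And>K :: real^'m^'m. Finite_Cartesian_Product.transpose K = K \<Longrightarrow>
      (\<And>i j. (i, j) \<notin> E \<Longrightarrow> K $ i $ j = 0) \<Longrightarrow> (\<And>k. k < n \<Longrightarrow> K *v x k = 0) \<Longrightarrow> K = 0"
  shows "mle_exists E (sample_covariance n x)"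
proof -
  let ?I = "Finite_Cartesian_Product.mat 1 :: real^'m^'m"
  define S where "S = sample_covariance n x"
  define T where "T K = Determinants.trace (S ** K)" for K
  have T: "T K = (1 / real n) * (\<Sum>k<n. x k \<bullet> (K *v x k))" if "K \<in> sparse_semidef E" for K
    using that by (simp add: T_def S_def trace_sample_covariance_mult sparse_semidef_def pos_semidef_def)
  have T_pos: "T K > 0" if K: "K \<in> sparse_semidef E" and "K \<noteq> 0" for K
  proof -
    have nonneg: "x k \<bullet> (K *v x k) \<ge> 0" for k using K by (auto simp: sparse_semidef_def pos_semidef_def)
    have "\<exists>k<n. K *v x k \<noteq> 0" using ker[of K] K \<open>K \<noteq> 0\<close> by (auto simp: sparse_semidef_def pos_semidef_def)
    then obtain k where "k < n" "x k \<bullet> (K *v x k) \<noteq> 0"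
      using pos_semidef_kernel K by (auto simp: sparse_semidef_def)
    then have "(\<Sum>k<n. x k \<bullet> (K *v x k)) > 0"
      using nonneg[of k] by (intro sum_pos2[of _ k] nonneg) auto
    then show ?thesis using n T[OF K] by simp
  qed
  have conc: "concentration_matrices E \<subseteq> sparse_semidef E"
    by (auto simp: concentration_matrices_def sparse_semidef_def pos_def_imp_semidef)
  have I: "?I \<in> concentration_matrices E"
    using E pos_def_id by (auto simp: concentration_matrices_def refl_on_def) (auto simp: Finite_Cartesian_Product.mat_def)
  have scale: "c *\<^sub>R K \<in> sparse_semidef E" if "K \<in> sparse_semidef E" "c \<ge> 0" for c K
    using that unfolding sparse_semidef_def pos_semidef_def transpose_eq_self_iff
    by (auto simp flip: scaleR_matrix_vector_assoc)
  let ?U = "sparse_semidef E \<inter> sphere 0 1"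
  have U: "compact ?U" by (intro closed_Int_compact closed_sparse_semidef compact_sphere)
  have unit: "(1 / norm K) *\<^sub>R K \<in> ?U" if "K \<in> sparse_semidef E" "K \<noteq> 0" for K
    using that by (auto intro: scale)
  have nz: "K \<noteq> 0" if "K \<in> concentration_matrices E" for K
    using that pos_def_det_nonzero[of K] Determinants.det_0 by (auto simp: concentration_matrices_def mat_0)
  have ne: "?U \<noteq> {}" using unit[of ?I] I nz conc by blast
  have "continuous_on ?U T" unfolding T_def by (intro continuous_intros)
  from continuous_attains_inf[OF U ne this] obtain K0 where K0: "K0 \<in> ?U" "\<And>K. K \<in> ?U \<Longrightarrow> T K0 \<le> T K" by blast
  have "continuous_on ?U Determinants.det" by (intro continuous_intros)
  from continuous_attains_sup[OF U ne this] obtain K1 where K1: "K1 \<in> ?U" "\<And>K. K \<in> ?U \<Longrightarrow> Determinants.det K \<le> Determinants.det K1" by blast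
  define c where "c = T K0"
  have c: "c > 0" unfolding c_def using K0(1) by (intro T_pos) auto
  define D where "D = Determinants.det K1"
  let ?m = "real CARD('m)"
  have bound: "log_likelihood S K \<le> ?m * ln (norm K) + ln D - c * norm K" if K: "K \<in> concentration_matrices E" for K
  proof -
    define \<rho> where "\<rho> = norm K"
    define Q where "Q = (1 / \<rho>) *\<^sub>R K"
    have \<rho>: "\<rho> > 0" using nz[OF K] by (simp add: \<rho>_def)
    have Q: "Q \<in> ?U" using unit[of K] K conc nz by (auto simp: Q_def \<rho>_def)
    have KQ: "K = \<rho> *\<^sub>R Q" using \<rho> by (simp add: Q_def)
    have det: "Determinants.det K = \<rho> ^ CARD('m) * Determinants.det Q" unfolding KQ by (rule det_scaleR)
    have "Determinants.det K > 0" using K by (auto simp: concentration_matrices_def intro: pos_def_det_pos)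
    with det \<rho> have detQ: "Determinants.det Q > 0" by (simp add: zero_less_mult_iff)
    have "ln (Determinants.det K) = ?m * ln \<rho> + ln (Determinants.det Q)"
      unfolding det using \<rho> detQ by (simp add: ln_mult ln_realpow)
    also have "ln (Determinants.det Q) \<le> ln D" using detQ K1(2)[OF Q] by (simp add: D_def)
    finally have "ln (Determinants.det K) \<le> ?m * ln \<rho> + ln D" by simp
    moreover have "T K = \<rho> * T Q"
      using T[of Q] T[of K] Q K conc by (auto simp: KQ sum_distrib_left mult_ac simp flip: scaleR_matrix_vector_assoc)
    then have "T K \<ge> c * \<rho>" using K0(2)[OF Q] \<rho> by (simp add: c_def mult.commute)
    ultimately show ?thesis by (simp add: log_likelihood_def T_def \<rho>_def)
  qed
  define L where "L = log_likelihood S ?I"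
  \<comment> \<open>With this slope the linear bound on \<open>ln (norm K * a)\<close> uses up
    exactly half of the term \<open>c * norm K\<close>.\<close>
  define a where "a = c / (2 * ?m)"
  have a: "a > 0" using c by (simp add: a_def)
  define R where "R = 2 * (ln D - ?m * ln a - L) / c"
  have norm_le: "norm K \<le> R" if K: "K \<in> concentration_matrices E" and "log_likelihood S K \<ge> L" for K
  proof -
    have \<rho>: "norm K > 0" using nz[OF K] by simp
    have "ln (norm K * a) \<le> norm K * a"
      using ln_le_minus_one[of "norm K * a"] \<rho> a by simp
    then have "ln (norm K) \<le> norm K * a - ln a" using \<rho> a by (simp add: ln_mult)
    then have "?m * ln (norm K) \<le> ?m * (norm K * a - ln a)" by (intro mult_left_mono) auto
    also have "\<dots> = c * norm K / 2 - ?m * ln a" by (simp add: a_def right_diff_distrib)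
    finally have "L \<le> ln D - ?m * ln a - c * norm K / 2" using bound[OF K] that(2) by linarith
    then show ?thesis using c by (simp add: R_def field_simps)
  qed
  \<comment> \<open>Contains every concentration matrix at least as likely as the identity; the
    determinant bound follows from positivity of the trace. It also keeps limits nonsingular, so
    that the maximizer over \<open>C\<close> is positive definite.\<close>
  define C where "C = sparse_semidef E \<inter> cball 0 R \<inter> {K. Determinants.det K \<ge> exp L}"
  have "closed {K :: real^'m^'m. Determinants.det K \<ge> exp L}"
    by (intro closed_Collect_le continuous_intros)
  then have C: "compact C" unfolding C_def
    by (intro compact_Int_closed closed_Int_compact closed_sparse_semidef compact_cball)
  have mem: "K \<in> C" if K: "K \<in> concentration_matrices E" and "log_likelihood S K \<ge> L" for K
  proof -
    have det: "Determinants.det K > 0" using K by (auto simp: concentration_matrices_def intro: pos_def_det_pos)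
    have "T K > 0" using T_pos K conc nz by blast
    with that(2) have "ln (Determinants.det K) \<ge> L" by (simp add: log_likelihood_def T_def)
    then have "Determinants.det K \<ge> exp L" using det by (simp add: ln_ge_iff)
    with norm_le[OF that] K conc show ?thesis by (auto simp: C_def)
  qed
  have det_pos: "Determinants.det K > 0" if "K \<in> C" for K
    using that less_le_trans[OF exp_gt_zero] by (auto simp: C_def)
  have "continuous_on C (log_likelihood S)"
    unfolding log_likelihood_def by (intro continuous_intros) (use det_pos in force)
  moreover have "C \<noteq> {}" using mem[OF I] by (auto simp: L_def)
  ultimately obtain K where K: "K \<in> C" "\<And>K'. K' \<in> C \<Longrightarrow> log_likelihood S K' \<le> log_likelihood S K"
    using continuous_attains_sup[OF C] by metis
  have "K \<in> concentration_matrices E"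
    using K(1) pos_semidef_det_nonzero_imp_pos_def[of K] det_pos[OF K(1)]
    by (auto simp: C_def sparse_semidef_def concentration_matrices_def)
  moreover have "log_likelihood S K' \<le> log_likelihood S K" if "K' \<in> concentration_matrices E" for K'
  proof (cases "log_likelihood S K' \<ge> L")
    case True
    then show ?thesis using K(2) mem that by blast
  next
    case False
    then show ?thesis using K(2)[OF mem[OF I]] by (simp add: L_def)
  qed
  ultimately show ?thesis unfolding mle_exists_def S_def by blast
qed

subsection \<open>Polynomials vanish almost nowhere\<close>

text \<open>Fubini and induction: with coordinate \<open>i\<close> frozen at its value in the
  witness \<open>z\<close>, the function is nonzero for almost all remaining coordinates, and each
  such point makes its section in direction \<open>i\<close> almost everywhere nonzero. Used over
  the coordinates of one vector and over the samples.\<close>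

lemma AE_PiM_nonzero:
  fixes f :: "('i \<Rightarrow> 'a) \<Rightarrow> real"
  assumes M: "product_sigma_finite M" and "finite I"
    and "f \<in> borel_measurable (PiM I M)"
    and "z \<in> space (PiM I M)" and "f z \<noteq> 0"
    and "\<And>i x. i \<in> I \<Longrightarrow> x \<in> space (PiM I M) \<Longrightarrow> f x \<noteq> 0 \<Longrightarrow> AE y in M i. f (x(i := y)) \<noteq> 0"
  shows "AE x in PiM I M. f x \<noteq> 0"
  using assms(2-)
proof (induction I arbitrary: f z rule: finite_induct)
  case empty
  then show ?case by (auto simp: space_PiM)
next
  case (insert i I)
  interpret product_sigma_finite M by (rule M)
  note [measurable] = insert.prems(1)
  define g where "g x = f (x(i := z i))" for x
  have zi: "z i \<in> space (M i)" using insert.prems(2) by (auto simp: space_PiM)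
  have upd: "x(i := y) \<in> space (PiM (insert i I) M)" if "x \<in> space (PiM I M)" "y \<in> space (M i)" for x y
    using that insert.hyps by (auto simp: space_PiM PiE_iff extensional_def)
  have g: "AE x in PiM I M. g x \<noteq> 0"
  proof (rule insert.IH)
    have "(\<lambda>x. x(i := z i)) \<in> measurable (PiM I M) (PiM (insert i I) M)"
      by (rule measurable_fun_upd[where J = I]) (use zi in auto)
    then show "g \<in> borel_measurable (PiM I M)" unfolding g_def by measurable
    show "restrict z I \<in> space (PiM I M)" using insert.prems(2) by (auto simp: space_PiM)
    have "(restrict z I)(i := z i) = z"
      using insert.prems(2) by (auto simp: space_PiM fun_eq_iff PiE_iff extensional_def)
    then show "g (restrict z I) \<noteq> 0" using insert.prems(3) by (simp add: g_def)
    fix j x assume jx: "j \<in> I" "x \<in> space (PiM I M)" "g x \<noteq> 0"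
    have "AE y in M j. f (x(i := z i, j := y)) \<noteq> 0"
      by (rule insert.prems(4)[OF _ upd[OF jx(2) zi] jx(3)[unfolded g_def]]) (use jx in simp)
    moreover have "j \<noteq> i" using jx insert.hyps by auto
    ultimately show "AE y in M j. g (x(j := y)) \<noteq> 0" by (simp add: g_def fun_upd_twist)
  qed
  define N where "N = {x \<in> space (PiM (insert i I) M). f x = 0}"
  have N [measurable]: "N \<in> sets (PiM (insert i I) M)" unfolding N_def by measurable
  have "emeasure (PiM (insert i I) M) N = (\<integral>\<^sup>+x. indicator N x \<partial>PiM (insert i I) M)" by simp
  also have "\<dots> = (\<integral>\<^sup>+x. (\<integral>\<^sup>+y. indicator N (x(i := y)) \<partial>M i) \<partial>PiM I M)"
    by (rule product_nn_integral_insert) (use insert.hyps in auto)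
  also have "\<dots> = (\<integral>\<^sup>+x. 0 \<partial>PiM I M)"
  proof (rule nn_integral_cong_AE, use g AE_space in eventually_elim)
    fix x assume x: "g x \<noteq> 0" "x \<in> space (PiM I M)"
    have "AE y in M i. f (x(i := y)) \<noteq> 0"
      using insert.prems(4)[OF insertI1 upd[OF x(2) zi] x(1)[unfolded g_def]] by (simp only: fun_upd_upd)
    then have "(\<integral>\<^sup>+y. indicator N (x(i := y)) \<partial>M i) = (\<integral>\<^sup>+y. 0 \<partial>M i)"
      by (intro nn_integral_cong_AE) (auto simp: N_def)
    then show "(\<integral>\<^sup>+y. indicator N (x(i := y)) \<partial>M i) = 0" by simp
  qed
  finally have "emeasure (PiM (insert i I) M) N = 0" by simp
  with N show ?case by (intro AE_I[of _ _ N]) (auto simp: N_def)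
qed

text \<open>On a line parallel to an axis through a point where \<open>h\<close> is nonzero,
  \<open>h\<close> is a nonzero univariate polynomial, hence has finitely many zeros. Lebesgue
  measure is the image of the product over the basis.\<close>

lemma AE_lborel_nonzero:
  fixes h :: "real^'m \<Rightarrow> real"
  assumes h: "h \<in> borel_measurable borel" and y0: "h y0 \<noteq> 0"
    and poly: "\<And>y i. \<exists>q. \<forall>s. h (\<chi> j. if j = i then s else y $ j) = poly q s"
  shows "AE y in lborel. h y \<noteq> 0"
proof -
  interpret L: product_sigma_finite "\<lambda>_ :: real^'m. lborel :: real measure"
    by unfold_locales
  let ?v = "\<lambda>\<phi>. (\<Sum>b\<in>Basis. \<phi> b *\<^sub>R b) :: real^'m"
  have v: "?v \<phi> $ j = \<phi> (axis j 1)" for \<phi> j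
    by (simp add: cart_eq_inner_axis inner_sum_left_Basis axis_in_Basis_iff del: sum_component)
  have vm: "?v \<in> measurable (PiM Basis (\<lambda>_. lborel)) borel" by measurable
  have "AE \<phi> in PiM Basis (\<lambda>_. lborel). h (?v \<phi>) \<noteq> 0"
  proof (rule AE_PiM_nonzero)
    show "product_sigma_finite (\<lambda>_ :: real^'m. lborel :: real measure)" by unfold_locales
    show "(\<lambda>\<phi>. h (?v \<phi>)) \<in> borel_measurable (PiM Basis (\<lambda>_. lborel))"
      using measurable_compose[OF vm h] .
    let ?z = "restrict (\<lambda>b. y0 \<bullet> b) Basis"
    show "?z \<in> space (PiM Basis (\<lambda>_. lborel))" by (simp add: space_PiM)
    have "?v ?z = y0" by (simp add: euclidean_representation)
    then show "h (?v ?z) \<noteq> 0" using y0 by simp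
    fix b :: "real^'m" and \<phi> assume b: "b \<in> Basis" and \<phi>: "h (?v \<phi>) \<noteq> 0"
    then obtain k where k: "b = axis k 1" by (auto simp: Basis_vec_def)
    have upd: "?v (\<phi>(b := s)) = (\<chi> j. if j = k then s else ?v \<phi> $ j)" for s
      by (simp only: Finite_Cartesian_Product.vec_eq_iff vec_lambda_beta v) (auto simp: k axis_eq_axis)
    from poly[of k "?v \<phi>"] obtain q where q: "\<And>s. h (?v (\<phi>(b := s))) = poly q s"
      unfolding upd by blast
    have "poly q (\<phi> b) \<noteq> 0" using \<phi> q[of "\<phi> b"] by simp
    then have "q \<noteq> 0" by auto
    then have "{s. poly q s = 0} \<in> null_sets lborel"
      by (intro finite_imp_null_set_lborel poly_roots_finite)
    then show "AE s in lborel. h (?v (\<phi>(b := s))) \<noteq> 0"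
      unfolding q by (rule AE_I') auto
  qed simp
  then show ?thesis using h vm by (subst lborel_eq, subst AE_distr_iff) auto
qed

lemma AE_gaussian:
  fixes \<Sigma> :: "real^'m^'m"
  assumes "AE y in lborel. Q y"
  shows "AE y in gaussian \<Sigma>. Q y"
proof -
  have "(\<lambda>x. x \<bullet> (matrix_inv \<Sigma> *v x)) \<in> borel_measurable borel"
    by (intro borel_measurable_continuous_onI continuous_intros linear_continuous_on
        matrix_vector_mul_bounded_linear)
  then have "(\<lambda>x. ennreal (exp (- (x \<bullet> (matrix_inv \<Sigma> *v x)) / 2) / sqrt ((2 * pi) ^ CARD('m) * Determinants.det \<Sigma>)))
    \<in> borel_measurable lborel" by measurable
  from AE_density[OF this] assms show ?thesis unfolding gaussian_def by auto
qed

text \<open>The assumption \<open>AE\<close> is absolute continuity of \<open>P\<close>: it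
  transfers the Lebesgue statement to one sample while the others are held fixed.\<close>

lemma polynomial_fun_AE_PiM:
  fixes P :: "(real^'m) measure" and n :: nat
  assumes g: "polynomial_fun (UNIV \<times> {..<n}) g" and x: "g x \<noteq> 0"
    and sets: "sets P = sets borel" and P: "sigma_finite_measure P"
    and AE: "\<And>Q. AE y in lborel. Q y \<Longrightarrow> AE y in P. Q y"
  shows "AE \<xi> in PiM {..<n} (\<lambda>_. P). g (\<lambda>(i, k). \<xi> k $ i) \<noteq> 0"
proof -
  let ?V = "UNIV \<times> {..<n} :: ('m \<times> nat) set"
  from g obtain d a where g: "\<And>x. g x = (\<Sum>s\<in>exps ?V d. a s * (\<Prod>v\<in>?V. x v ^ s v))"
    unfolding polynomial_fun_def poly_fun_def by blast
  have g_cong: "g x = g x'" if "\<And>v. v \<in> ?V \<Longrightarrow> x v = x' v" for x x'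
    unfolding g using that by (intro sum.cong arg_cong2[of _ _ _ _ "(*)"] prod.cong) auto
  show ?thesis
  proof (rule AE_PiM_nonzero)
    show "product_sigma_finite (\<lambda>_. P)" using P by (simp add: product_sigma_finite_def)
    have "(\<lambda>\<xi>. \<xi> k $ i) \<in> borel_measurable (PiM {..<n} (\<lambda>_. P))" if "k < n" for k and i :: 'm
    proof -
      have "(\<lambda>\<xi>. \<xi> k) \<in> measurable (PiM {..<n} (\<lambda>_. P)) borel"
        unfolding measurable_cong_sets[OF refl sets, symmetric]
        by (rule measurable_component_singleton) (use that in simp)
      moreover have "(\<lambda>y :: real^'m. y $ i) \<in> borel_measurable borel"
        by (intro borel_measurable_continuous_onI continuous_intros)
      ultimately show ?thesis by (rule measurable_compose)
    qed
    then show "(\<lambda>\<xi>. g (\<lambda>(i, k). \<xi> k $ i)) \<in> borel_measurable (PiM {..<n} (\<lambda>_. P))"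
      unfolding g by (intro borel_measurable_sum borel_measurable_times borel_measurable_const borel_measurable_prod borel_measurable_power) auto
    let ?z = "\<lambda>k\<in>{..<n}. \<chi> i. x (i, k)"
    show "?z \<in> space (PiM {..<n} (\<lambda>_. P))" using sets_eq_imp_space_eq[OF sets] by (simp add: space_PiM)
    have "g (\<lambda>(i, k). ?z k $ i) = g x" by (rule g_cong) auto
    then show "g (\<lambda>(i, k). ?z k $ i) \<noteq> 0" using x by simp
    fix k \<xi> assume k: "k \<in> {..<n}" and nz: "g (\<lambda>(i, k). \<xi> k $ i) \<noteq> 0"
    let ?h = "\<lambda>y :: real^'m. g (\<lambda>(i, l). (\<xi>(k := y)) l $ i)"
    show "AE y in P. ?h y \<noteq> 0"
    proof (rule AE, rule AE_lborel_nonzero)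
      have "(\<lambda>y. (\<xi>(k := y)) l $ i) \<in> borel_measurable borel" for l i
        by (cases "l = k") (auto intro!: borel_measurable_continuous_onI continuous_intros)
      then show "?h \<in> borel_measurable borel"
        unfolding g by (intro borel_measurable_sum borel_measurable_times borel_measurable_const borel_measurable_prod borel_measurable_power) auto
      show "?h (\<xi> k) \<noteq> 0" using nz by simp
      fix y i
      \<comment> \<open>\<open>g\<close> as a polynomial in the single entry
        \<open>(i, k)\<close>.\<close>
      define q where "q = (\<Sum>t\<in>exps ?V d. Polynomial.smult (a t)
        (\<Prod>v\<in>?V. (if v = (i, k) then [:0, 1:] else [:(\<xi>(k := y)) (snd v) $ fst v:]) ^ t v))"
      have "?h (\<chi> j. if j = i then s else y $ j) = poly q s" for s
      proof -
        have "poly q s = (\<Sum>t\<in>exps ?V d. a t *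
          (\<Prod>v\<in>?V. poly (if v = (i, k) then [:0, 1:] else [:(\<xi>(k := y)) (snd v) $ fst v:]) s ^ t v))"
          by (simp add: q_def poly_sum poly_prod poly_power)
        also have "\<dots> = ?h (\<chi> j. if j = i then s else y $ j)"
          unfolding g
        proof (intro sum.cong refl arg_cong2[of _ _ _ _ "(*)"] prod.cong arg_cong2[of _ _ _ _ "(^)"])
          fix v :: "'m \<times> nat"
          show "poly (if v = (i, k) then [:0, 1:] else [:(\<xi>(k := y)) (snd v) $ fst v:]) s =
            (case v of (i', l) \<Rightarrow> (\<xi>(k := \<chi> j. if j = i then s else y $ j)) l $ i')"
            by (cases v) auto
        qed
        finally show ?thesis by simp
      qed
      then show "\<exists>q. \<forall>s. ?h (\<chi> j. if j = i then s else y $ j) = poly q s" by blast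
    qed
  qed simp
qed

section \<open>Algebraic independence of the Gram map and almost sure existence\<close>

definition edge_unknowns :: "('m \<times> 'm) set \<Rightarrow> 'm uprod set" where
  "edge_unknowns E = {Upair i j | i j. (i, j) \<in> E}"

text \<open>A relation among the edge components of the Gram map is a polynomial \<open>F\<close> in
  the edge unknowns that vanishes on all Gram matrices of \<open>n\<close> columns. Hence
  \<open>F = 0\<close>, and its coefficients are those of the relation.\<close>

lemma alg_indep_gram:
  fixes E :: "('m::finite \<times> 'm) set"
  assumes elim: "elimination_ideal E n = {0}"
    and \<psi>: "\<And>i j. \<psi> (Upair i j) = (\<lambda>x. \<Sum>k<n. x (i, k) * x (j, k))"
  shows "alg_indep (Inl ` edge_unknowns E) (case_sum \<psi> (\<lambda>v x. x v))"
  unfolding alg_indep_def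
proof (intro allI impI ballI)
  let ?I = "edge_unknowns E" and ?y = "case_sum \<psi> (\<lambda>v x. x v)"
  fix d and c :: "('m uprod + 'm \<times> nat \<Rightarrow> nat) \<Rightarrow> real" and t0
  let ?T = "exps (Inl ` ?I :: ('m uprod + 'm \<times> nat) set) d"
  assume 0: "\<forall>x. (\<Sum>t\<in>?T. c t * (\<Prod>i\<in>Inl ` ?I. ?y i x ^ t i)) = 0" and t0: "t0 \<in> ?T"
  \<comment> \<open>Distinct exponent vectors in \<open>?T\<close> give distinct monomials, so no
    coefficients merge in \<open>F\<close>.\<close>
  define m where "m t = Abs_poly_mapping (\<lambda>e. if e \<in> ?I then t (Inl e) else 0)"
    for t :: "'m uprod + 'm \<times> nat \<Rightarrow> nat"
  have fin: "finite A" for A :: "'m uprod set" by (rule finite_subset[OF subset_UNIV]) simp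
  have lookup_m: "Poly_Mapping.lookup (m t) = (\<lambda>e. if e \<in> ?I then t (Inl e) else 0)" for t
    unfolding m_def by (rule lookup_Abs_poly_mapping) (rule fin)
  have keys_m: "Poly_Mapping.keys (m t) \<subseteq> ?I" for t
    by (auto simp: in_keys_iff lookup_m split: if_splits)
  have inj: "t = t'" if "t \<in> ?T" "t' \<in> ?T" "m t = m t'" for t t'
  proof (rule PiE_ext[OF that(1,2)])
    fix i :: "'m uprod + 'm \<times> nat" assume "i \<in> Inl ` ?I"
    then obtain e where "i = Inl e" "e \<in> ?I" by blast
    then show "t i = t' i" using fun_cong[OF arg_cong[OF that(3), of Poly_Mapping.lookup], of e] by (simp add: lookup_m)
  qed
  have fT: "finite ?T" using fin by simp
  define F where "F = (\<Sum>t\<in>?T. Poly_Mapping.single (m t) (c t))"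
  have "mpoly_vars F \<subseteq> ?I"
  proof
    fix v assume "v \<in> mpoly_vars F"
    then obtain r where r: "r \<in> Poly_Mapping.keys F" "v \<in> Poly_Mapping.keys r" by (auto simp: mpoly_vars_def)
    then have "(\<Sum>t\<in>?T. Poly_Mapping.lookup (Poly_Mapping.single (m t) (c t)) r) \<noteq> 0"
      by (simp add: in_keys_iff F_def lookup_sum)
    then obtain t where "Poly_Mapping.lookup (Poly_Mapping.single (m t) (c t)) r \<noteq> 0"
      by (rule sum.not_neutral_contains_not_neutral)
    then have "r = m t" by (auto simp: lookup_single when_def split: if_splits)
    with r keys_m show "v \<in> ?I" by blast
  qed
  then have FE: "F \<in> edge_subring E" by (simp add: edge_subring_def edge_unknowns_def)
  have "F = 0"
  proof (rule vanishing_on_gram_eq_0[OF elim FE])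
    fix \<sigma> :: "'m uprod \<Rightarrow> real" and Y
    assume \<sigma>: "\<And>i j. \<sigma> (Upair i j) = (\<Sum>l<n. Y i l * Y j l)"
    have \<sigma>': "\<sigma> e = \<psi> e (\<lambda>(i, k). Y i k)" for e by (cases e) (simp add: \<sigma> \<psi>)
    have "mpoly_eval \<sigma> F = (\<Sum>t\<in>?T. c t * (\<Prod>e\<in>?I. \<sigma> e ^ t (Inl e)))"
      unfolding F_def mpoly_eval.hom_sum mpoly_eval_single
      by (intro sum.cong refl arg_cong2[of _ _ _ _ "(*)"])
         (subst monom_eval_superset[OF fin keys_m], auto simp: lookup_m intro!: prod.cong)
    also have "\<dots> = (\<Sum>t\<in>?T. c t * (\<Prod>i\<in>Inl ` ?I. ?y i (\<lambda>(i, k). Y i k) ^ t i))"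
      by (simp add: prod.reindex \<sigma>')
    finally show "mpoly_eval \<sigma> F = 0" using 0 by simp
  qed
  then have "0 = Poly_Mapping.lookup F (m t0)" by simp
  also have "\<dots> = (\<Sum>t\<in>?T. if t = t0 then c t else 0)"
    unfolding F_def lookup_sum by (intro sum.cong refl) (use inj t0 in \<open>auto simp: lookup_single when_def\<close>)
  also have "\<dots> = c t0" using t0 fT by simp
  finally show "c t0 = 0" by simp
qed

theorem theorem3p3:
  fixes E :: "('m::finite \<times> 'm) set"
    and n :: nat
    and M :: "'a measure"
    and P :: "(real^'m) measure"
    and X :: "nat \<Rightarrow> 'a \<Rightarrow> real^'m"
  assumes "sym E" and "refl E"
    and "n \<ge> 1"
    and "elimination_ideal E n = {0}"
    and "P \<in> gaussian_model E"
    and "prob_space M"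
    and "prob_space.indep_vars M (\<lambda>_. borel) X {..<n}"
    and "\<And>k. k < n \<Longrightarrow> distr M borel (X k) = P"
  shows "AE \<omega> in M. mle_exists E (sample_covariance n (\<lambda>k. X k \<omega>))"
proof -
  interpret prob_space M by fact
  let ?V = "UNIV \<times> {..<n} :: ('m \<times> nat) set" and ?I = "edge_unknowns E"
  obtain \<psi> where \<psi>: "\<And>i j :: 'm. \<psi> (Upair i j) = (\<lambda>x :: 'm \<times> nat \<Rightarrow> real. \<Sum>k<n. x (i, k) * x (j, k))"
    by (rule uprod_lift[of "\<lambda>i j x. \<Sum>k<n. x (i, k) * x (j, k)"]) (auto simp: mult.commute)
  \<comment> \<open>The partial derivatives of \<open>\<psi>\<close>. For a loop both summands
    contribute, which gives the factor 2 in the derivative of a square.\<close>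
  obtain p :: "'m uprod \<Rightarrow> ('m \<times> nat \<Rightarrow> real) \<Rightarrow> 'm \<times> nat \<Rightarrow> real" where p: "\<And>i j :: 'm. p (Upair i j) = (\<lambda>x (a, k). (if a = i then x (j, k) else 0) + (if a = j then x (i, k) else (0::real)))"
    by (rule uprod_lift[of "\<lambda>i j x (a, k). (if a = i then x (j, k) else 0) + (if a = j then x (i, k) else 0)"])
       (auto simp: add.commute fun_eq_iff)
  have psum: "(\<Sum>v\<in>?V. u v * p (Upair i j) x v) = (\<Sum>k<n. u (i, k) * x (j, k) + u (j, k) * x (i, k))" for i j x u
  proof -
    have "(\<Sum>v\<in>?V. u v * p (Upair i j) x v) = (\<Sum>a\<in>UNIV. \<Sum>k<n. u (a, k) * p (Upair i j) x (a, k))"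
      by (simp add: sum.cartesian_product)
    also have "\<dots> = (\<Sum>k<n. \<Sum>a\<in>UNIV. (if a = i then u (a, k) * x (j, k) else 0) + (if a = j then u (a, k) * x (i, k) else 0))"
      unfolding p by (subst sum.swap) (auto intro!: sum.cong simp: distrib_left)
    finally show ?thesis by (simp add: sum.distrib)
  qed
  have \<psi>_poly: "polynomial_fun ?V (\<psi> e)" for e
    by (cases e) (auto simp: \<psi> intro!: polynomial_fun_sum polynomial_fun_intros)
  have \<psi>_deriv: "((\<lambda>s. \<psi> e (\<lambda>v. x v + s * u v)) has_real_derivative (\<Sum>v\<in>?V. u v * p e x v)) (at 0)" for e x u
    by (cases e) (auto simp: \<psi> psum intro!: derivative_eq_intros sum.cong)
  have fin: "finite ?V" "finite ?I" by (auto intro: finite_subset[OF subset_UNIV])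
  from jacobian_criterion[of ?V ?I \<psi> p, OF fin \<psi>_poly alg_indep_gram[OF assms(4) \<psi>] \<psi>_deriv]
  obtain G where G: "finite G" "\<forall>g\<in>G. polynomial_fun ?V g \<and> (\<exists>x. g x \<noteq> 0)"
    and G_indep: "\<forall>x \<kappa>. (\<forall>g\<in>G. g x \<noteq> 0) \<longrightarrow>
      (\<forall>u. (\<Sum>i\<in>?I. \<kappa> i * (\<Sum>v\<in>?V. u v * p i x v)) = 0) \<longrightarrow> (\<forall>i\<in>?I. \<kappa> i = 0)"
    by (elim exE conjE)
  obtain \<Sigma> where P\<Sigma>: "P = gaussian \<Sigma>" using assms(5) by (auto simp: gaussian_model_def)
  have rv: "random_variable borel (X k)" if "k \<in> {..<n}" for k
    using assms(7) that by (auto simp: indep_vars_def)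
  have "prob_space P" using assms(3) assms(8)[of 0] prob_space_distr[OF rv[of 0]] by auto
  then have sf: "sigma_finite_measure P"
    by (intro finite_measure.sigma_finite_measure prob_space.finite_measure)
  have sets: "sets P = sets borel" using assms(3) assms(8)[of 0] by (metis less_le_trans less_one sets_distr)
  \<comment> \<open>Restricted to the sample indices because points of the product space are
    extensional.\<close>
  let ?\<xi> = "\<lambda>\<omega>. \<lambda>k\<in>{..<n}. X k \<omega>"
  have \<xi>m: "?\<xi> \<in> measurable M (PiM {..<n} (\<lambda>_. borel))" using rv by (intro measurable_restrict) auto
  have "distr M (PiM {..<n} (\<lambda>_. borel)) ?\<xi> = PiM {..<n} (\<lambda>k. distr M borel (X k))"
  proof (subst indep_vars_iff_distr_eq_PiM'[symmetric])
    show "{..<n} \<noteq> {}" using assms(3) by (auto simp: lessThan_empty_iff)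
  qed (use assms(7) rv in auto)
  also have "\<dots> = PiM {..<n} (\<lambda>_. P)" using assms(8) by (intro PiM_cong) auto
  finally have distr: "distr M (PiM {..<n} (\<lambda>_. borel)) ?\<xi> = PiM {..<n} (\<lambda>_. P)" .
  have "AE \<omega> in M. g (\<lambda>(i, k). ?\<xi> \<omega> k $ i) \<noteq> 0" if g: "g \<in> G" for g
  proof -
    obtain x where "polynomial_fun ?V g" "g x \<noteq> 0" using G(2) g by blast
    from polynomial_fun_AE_PiM[OF this sets sf] AE_gaussian
    have "AE \<xi> in PiM {..<n} (\<lambda>_. P). g (\<lambda>(i, k). \<xi> k $ i) \<noteq> 0" unfolding P\<Sigma> by blast
    then show ?thesis unfolding distr[symmetric] by (rule AE_distrD[OF \<xi>m])
  qed
  then have "AE \<omega> in M. \<forall>g\<in>G. g (\<lambda>(i, k). ?\<xi> \<omega> k $ i) \<noteq> 0"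
    using G(1) by (simp add: AE_finite_all)
  then show ?thesis
  proof eventually_elim
    fix \<omega> assume nz: "\<forall>g\<in>G. g (\<lambda>(i, k). ?\<xi> \<omega> k $ i) \<noteq> 0"
    let ?x = "\<lambda>(i, k). ?\<xi> \<omega> k $ i"
    show "mle_exists E (sample_covariance n (\<lambda>k. X k \<omega>))"
    proof (rule mle_exists_if_no_sparse_kernel[OF assms(2,3)])
      fix K :: "real^'m^'m"
      assume tr: "Finite_Cartesian_Product.transpose K = K" and sparse: "\<And>i j. (i, j) \<notin> E \<Longrightarrow> K $ i $ j = 0"
        and ker: "\<And>k. k < n \<Longrightarrow> K *v X k \<omega> = 0"
      have Ksym: "K $ i $ j = K $ j $ i" for i j using tr by (simp add: transpose_eq_self_iff)
      have rows: "(\<Sum>j\<in>UNIV. K $ i $ j * ?x (j, k)) = 0" if "k < n" for i k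
        using ker[OF that] that by (simp add: Finite_Cartesian_Product.vec_eq_iff matrix_vector_mult_def)
      \<comment> \<open>The sum runs over ordered pairs: a proper edge collects
        \<open>K $ i $ j\<close> and \<open>K $ j $ i\<close>, a loop only its diagonal
        entry.\<close>
      define \<kappa> where "\<kappa> e = (\<Sum>q\<in>{q \<in> E. Upair (fst q) (snd q) = e}. K $ fst q $ snd q)" for e
      have \<kappa>0: "\<forall>e\<in>?I. \<kappa> e = 0"
      proof (rule G_indep[THEN spec, THEN spec, THEN mp, THEN mp], rule nz, rule allI)
        fix u
        let ?w = "\<lambda>e. \<Sum>v\<in>?V. u v * p e ?x v"
        \<comment> \<open>Unfolded, this pairing is twice the sum over \<open>k\<close> of the inner
          products of \<open>u (_, k)\<close> with \<open>K *v X k \<omega>\<close>, which is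
          zero.\<close>
        have "(\<Sum>e\<in>?I. \<kappa> e * ?w e)
          = (\<Sum>e\<in>?I. \<Sum>q\<in>{q \<in> E. Upair (fst q) (snd q) = e}. K $ fst q $ snd q * ?w (Upair (fst q) (snd q)))"
          unfolding \<kappa>_def by (auto simp: sum_distrib_right intro!: sum.cong)
        also have "\<dots> = (\<Sum>q\<in>E. K $ fst q $ snd q * ?w (Upair (fst q) (snd q)))"
        proof (rule sum.group)
          show "(\<lambda>q. Upair (fst q) (snd q)) ` E \<subseteq> ?I"
          proof (rule image_subsetI)
            fix q assume "q \<in> E"
            then have "(fst q, snd q) \<in> E" by simp
            then show "Upair (fst q) (snd q) \<in> ?I" unfolding edge_unknowns_def by blast
          qed
        qed (use fin in auto)
        also have "\<dots> = (\<Sum>q\<in>UNIV. K $ fst q $ snd q * ?w (Upair (fst q) (snd q)))"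
          by (rule sum.mono_neutral_left) (auto simp: sparse)
        also have "\<dots> = (\<Sum>i\<in>UNIV. \<Sum>j\<in>UNIV. K $ i $ j * (\<Sum>k<n. u (i, k) * ?x (j, k) + u (j, k) * ?x (i, k)))"
          unfolding psum UNIV_Times_UNIV[symmetric] by (simp add: sum.cartesian_product case_prod_unfold)
        also have "\<dots> = (\<Sum>i\<in>UNIV. \<Sum>j\<in>UNIV. \<Sum>k<n. K $ i $ j * (u (i, k) * ?x (j, k)))
          + (\<Sum>i\<in>UNIV. \<Sum>j\<in>UNIV. \<Sum>k<n. K $ i $ j * (u (j, k) * ?x (i, k)))"
          by (simp only: sum_distrib_left distrib_left sum.distrib)
        also have "(\<Sum>i\<in>UNIV. \<Sum>j\<in>UNIV. \<Sum>k<n. K $ i $ j * (u (j, k) * ?x (i, k)))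
          = (\<Sum>i\<in>UNIV. \<Sum>j\<in>UNIV. \<Sum>k<n. K $ i $ j * (u (i, k) * ?x (j, k)))"
          by (subst sum.swap) (intro sum.cong refl, simp add: Ksym)
        also have "(\<Sum>i\<in>UNIV. \<Sum>j\<in>UNIV. \<Sum>k<n. K $ i $ j * (u (i, k) * ?x (j, k))) = 0"
        proof (rule sum.neutral, rule ballI)
          fix i
          have "(\<Sum>j\<in>UNIV. \<Sum>k<n. K $ i $ j * (u (i, k) * ?x (j, k)))
            = (\<Sum>k<n. u (i, k) * (\<Sum>j\<in>UNIV. K $ i $ j * ?x (j, k)))"
            by (subst sum.swap) (simp only: sum_distrib_left mult_ac)
          also have "\<dots> = 0" using rows by (intro sum.neutral) auto
          finally show "(\<Sum>j\<in>UNIV. \<Sum>k<n. K $ i $ j * (u (i, k) * ?x (j, k))) = 0" .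
        qed
        finally show "(\<Sum>e\<in>?I. \<kappa> e * ?w e) = 0" by simp
      qed
      have "K $ i $ j = 0" for i j
      proof (cases "(i, j) \<in> E")
        case True
        then have ji: "(j, i) \<in> E" using assms(1) by (auto simp: sym_def)
        have "{q \<in> E. Upair (fst q) (snd q) = Upair i j} = {(i, j), (j, i)}" using True ji by auto
        then have "\<kappa> (Upair i j) = (if i = j then K $ i $ j else 2 * K $ i $ j)"
          by (auto simp: \<kappa>_def Ksym)
        moreover have "Upair i j \<in> ?I" unfolding edge_unknowns_def using True by blast
        ultimately show ?thesis using \<kappa>0 by (auto split: if_splits)
      qed (rule sparse)
      then show "K = 0" by (simp add: Finite_Cartesian_Product.vec_eq_iff)
    qed
  qed
qed

end
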